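(* Let $n\equiv 1\pmod 4$ be a positive integer and define \[B(n,q)=\frac{(n^2-1)(1-q)^2}{24}+\sum_{k=1}^{(n-1)/4}\frac{q^{4k-2}}{[4k-2]^2}.\] Then, modulo $[n]\Phi_n(q)^3$, \[\sum_{k=0}^{(n-1) / 2}[6 k+1] \frac{(q ; q^{4})_{k}(q ; q^{2})_{k}^{3}}{\left(q^{2} ; q^{2}\right)_{k}(q^{4} ; q^{4})_{k}^{3}} q^{k^{2}+k} \equiv \frac{\left(q^{2} ; q^{4}\right)_{(n-1)/4}}{\left(q^{4} ; q^{4}\right)_{(n-1)/4}}[n] q^{(1-n) / 4}\big\{1+[n]^2B(n,q)\big\}.\]
   Context: $(a;q)_m=(1-a)(1-aq)\cdots(1-aq^{m-1})$ (with $(a;q)_0=1$) is the $q$-shifted factorial. The $q$-integer is $[m]=(1-q^m)/(1-q)$. $\Phi_n(q)$ denotes the $n$-th cyclotomic polynomial. A congruence between rational functions modulo a polynomial $P(q)$ means that the numerator of the reduced difference is divisible by $P(q)$ while its denominator is coprime to $P(q)$. *)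

theory Defs
  imports
    Complex_Main
    "HOL-Computational_Algebra.Computational_Algebra"
    "HOL-Number_Theory.Cong"
begin

definition qpoch :: "'a::field \<Rightarrow> 'a \<Rightarrow> nat \<Rightarrow> 'a" where
  "qpoch a q m = (\<Prod>j<m. 1 - a * q ^ j)"

definition qint :: "'a::field \<Rightarrow> nat \<Rightarrow> 'a" where
  "qint q m = (1 - q ^ m) / (1 - q)"

definition B :: "nat \<Rightarrow> 'a::field \<Rightarrow> 'a" where
  "B n q = (of_nat n ^ 2 - 1) * (1 - q) ^ 2 / 24
     + (\<Sum>k=1..(n - 1) div 4. q ^ (4 * k - 2) / qint q (4 * k - 2) ^ 2)"

type_synonym ratfun = "complex poly fract"

definition qvar :: ratfun where
  "qvar = to_fract [:0, 1:]"

definition cyclotomic :: "nat \<Rightarrow> complex poly" where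
  "cyclotomic n = (\<Prod>k | k \<in> {1..n} \<and> coprime k n. [:- cis (2 * pi * real k / real n), 1:])"

(* The q-integer as an element of the polynomial ring, where it serves as a modulus;
   the division is exact, see to_fract_qint_poly. *)
definition qint_poly :: "nat \<Rightarrow> complex poly" where
  "qint_poly m = (1 - [:0, 1:] ^ m) div (1 - [:0, 1:])"

lemma to_fract_power: "to_fract (x ^ m) = to_fract x ^ m"
  by (induction m) simp_all

lemma to_fract_qint_poly: "to_fract (qint_poly m) = qint qvar m"
proof -
  let ?X = "[:0, 1:] :: complex poly"
  have nz: "1 - ?X \<noteq> 0"
    by (simp add: one_pCons)
  have "1 - ?X dvd 1 - ?X ^ m"
    by (metis dvd_triv_left one_diff_power_eq)
  then have "(1 - ?X) * qint_poly m = 1 - ?X ^ m"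
    unfolding qint_poly_def by simp
  then have "to_fract ((1 - ?X) * qint_poly m) = to_fract (1 - ?X ^ m)"
    by (rule arg_cong)
  then have "(1 - qvar) * to_fract (qint_poly m) = 1 - qvar ^ m"
    unfolding qvar_def by (simp only: to_fract_mult to_fract_diff to_fract_1 to_fract_power)
  moreover have "1 - qvar \<noteq> 0"
    using nz unfolding qvar_def by (metis to_fract_1 to_fract_diff to_fract_eq_0_iff)
  ultimately show ?thesis
    unfolding qint_def by (simp add: field_simps)
qed

(* N / D is the difference in lowest terms. *)
definition ratfun_cong :: "ratfun \<Rightarrow> ratfun \<Rightarrow> complex poly \<Rightarrow> bool" where
  "ratfun_cong f g P \<longleftrightarrow>
     (\<exists>N D. D \<noteq> 0 \<and> coprime N D \<and> f - g = to_fract N / to_fract D \<and>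
        P dvd N \<and> coprime D P)"

end

theory Submission
  imports
    Defs
    "HOL-Computational_Algebra.Field_as_Ring"
    "HOL-Library.Function_Algebras"
begin

text \<open>
  Put \<open>p = q\<^sup>2\<close>. The sum is the case \<open>a = q\<close>, \<open>u = v = q\<close>, \<open>w = 1/q\<close> of a quadratic sum
  \<open>S(a, u, v, w)\<close> with \<open>u v = p\<close>. Telescoping gives
  \<open>S(w p\<^sup>2) (1 - apuw) (1 - apvw) = S(w) (1 - apw) (1 - ap\<^sup>2w)\<close> whenever the sum terminates, which
  determines \<open>S\<close> at \<open>w = p\<^sup>2\<^sup>m\<close> and, by interpolation in \<open>w\<close>, for \<open>u = p\<^sup>-\<^sup>M\<close>; for \<open>a = p\<^sup>-\<^sup>M\<close>
  it forces \<open>S = 0\<close>.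

  Let \<open>\<zeta>\<close> be a primitive \<open>n\<close>-th root of unity. Moving \<open>(u, v)\<close> from \<open>(q, q)\<close> to
  \<open>(q/q\<^sup>n, q q\<^sup>n)\<close> changes \<open>u + v\<close> to second order at \<open>\<zeta>\<close>, while moving \<open>w\<close> from \<open>1/q\<close> to
  \<open>q\<^sup>n/q\<close> and \<open>a\<close> from \<open>q\<close> to \<open>q/q\<^sup>n\<close> are first order changes. Hence the mixed third difference of \<open>S\<close>
  over the resulting cube vanishes to order 4 at \<open>\<zeta>\<close>. The four vertices with \<open>a = q/q\<^sup>n\<close> contribute
  nothing and three of the others have closed forms, so the remaining one, the wanted sum, is known
  modulo \<open>\<Phi>\<^sub>n(q)\<^sup>4\<close>. The constant \<open>(n\<^sup>2 - 1)/24\<close> comes from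
  \<open>\<Sum>\<^sub>j y\<^sup>j/(1 - y\<^sup>j)\<^sup>2 = -(n\<^sup>2 - 1)/12\<close> over \<open>0 < j < n\<close> for a primitive root \<open>y\<close>.

  At a primitive \<open>d\<close>-th root of unity with \<open>d\<close> a proper divisor of \<open>n\<close>, the summand is multiplicative
  along blocks of length \<open>d\<close>, and each block sums to zero by the case \<open>a = p\<^sup>-\<^sup>M\<close> with \<open>d\<close> in place of \<open>n\<close>.
\<close>

section \<open>A quadratic basic hypergeometric summation\<close>

text \<open>The part of the summand that is free of \<open>w\<close>. The shifted factorials in
  bases \<open>p\<close> and \<open>p ^ 2\<close> form one running product, so consecutive indices
  differ by a single factor.\<close>

definition quad_coef :: "'a::field \<Rightarrow> 'a \<Rightarrow> 'a \<Rightarrow> 'a \<Rightarrow> nat \<Rightarrow> 'a" where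
  "quad_coef p a u v k = (\<Prod>j<k. (1 - a * p ^ j) * ((1 - u * p ^ j) * (1 - v * p ^ j)) * (a * p ^ (j + 1))
     / ((1 - p ^ (2 * j + 2)) * ((1 - a * p * u * p ^ (2 * j)) * (1 - a * p * v * p ^ (2 * j)))))"

text \<open>\<open>quad_sum\<close> cleared of its denominators, hence a polynomial in
  \<open>w\<close>. Interpolation needs this form, also at points where a denominator
  vanishes.\<close>

definition quad_num :: "'a::field \<Rightarrow> 'a \<Rightarrow> 'a \<Rightarrow> 'a \<Rightarrow> nat \<Rightarrow> 'a \<Rightarrow> 'a" where
  "quad_num p a u v M w = (\<Sum>k\<le>M. (1 - a * p ^ (3 * k)) * quad_coef p a u v k
     * (\<Prod>j<k. w - p ^ (2 * j)) * (\<Prod>i=k..<M. 1 - a * p ^ (i + 1) * w))"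

text \<open>For \<open>w \<noteq> 0\<close> the product of the \<open>w - p ^ (2 * j)\<close> is
  \<open>w ^ k\<close> times the shifted factorial of \<open>1 / w\<close> in base
  \<open>p ^ 2\<close>; the summation is of Gasper-Rahman quadratic type.\<close>

definition quad_sum :: "'a::field \<Rightarrow> 'a \<Rightarrow> 'a \<Rightarrow> 'a \<Rightarrow> nat \<Rightarrow> 'a \<Rightarrow> 'a" where
  "quad_sum p a u v M w = (\<Sum>k\<le>M. (1 - a * p ^ (3 * k)) * quad_coef p a u v k
     * (\<Prod>j<k. w - p ^ (2 * j)) / (\<Prod>i<k. 1 - a * p ^ (i + 1) * w))"

lemma quad_sum_eq_num:
  fixes w :: "'a::field"
  assumes "\<And>i. i < M \<Longrightarrow> 1 - a * p ^ (i + 1) * w \<noteq> 0"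
  shows "quad_sum p a u v M w = quad_num p a u v M w / (\<Prod>i<M. 1 - a * p ^ (i + 1) * w)"
proof -
  have *: "X / (\<Prod>i<k. 1 - a * p ^ (i + 1) * w)
      = X * (\<Prod>i=k..<M. 1 - a * p ^ (i + 1) * w) / (\<Prod>i<M. 1 - a * p ^ (i + 1) * w)"
    if "k \<le> M" for X k
  proof -
    have split: "(\<Prod>i<M. 1 - a * p ^ (i + 1) * w)
        = (\<Prod>i<k. 1 - a * p ^ (i + 1) * w) * (\<Prod>i=k..<M. 1 - a * p ^ (i + 1) * w)"
      using prod.atLeastLessThan_concat[of 0 k M "\<lambda>i. 1 - a * p ^ (i + 1) * w"] that
      by (simp add: atLeast0LessThan)
    have "(\<Prod>i=k..<M. 1 - a * p ^ (i + 1) * w) \<noteq> 0"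
      using assms by simp
    then show ?thesis
      unfolding split by simp
  qed
  show ?thesis
    unfolding quad_sum_def quad_num_def sum_divide_distrib by (intro sum.cong refl *) simp
qed

text \<open>Passing from \<open>w\<close> to \<open>w * p ^ 2\<close> lowers the index of each
  factor by one, up to \<open>p ^ 2\<close>; the factor at \<open>j = 0\<close> is left
  over.\<close>

lemma prod_shift_two:
  fixes w p :: "'a::comm_ring_1"
  shows "(\<Prod>j<Suc K. w * p ^ 2 - p ^ (2 * j)) = p ^ (2 * K) * (w * p ^ 2 - 1) * (\<Prod>j<K. w - p ^ (2 * j))"
proof (induction K)
  case (Suc K)
  have "w * p ^ 2 - p ^ (2 * Suc K) = p ^ 2 * (w - p ^ (2 * K))"
    by (simp add: algebra_simps power2_eq_square)
  then show ?case
    using Suc.IH by (simp add: prod.lessThan_Suc[of _ "Suc K"]) (simp add: algebra_simps power2_eq_square)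
qed simp

lemma prod_ivl_shift2: "(\<Prod>i=k..<M. e (i + 2)) = (\<Prod>i=k+2..<M+2::nat. e i)"
  by (rule prod.shift_bounds_nat_ivl[symmetric])

lemma prod_ivl_snoc2: "k \<le> M \<Longrightarrow> (\<Prod>i=k..<M. e i) * (e M * e (M + 1)) = (\<Prod>i=k..<M+2::nat. e i)"
  for e :: "nat \<Rightarrow> 'a::comm_monoid_mult"
  by (simp add: mult.assoc)

text \<open>The polynomial identity behind the induction step of the telescoping, with
  \<open>z\<close> standing for \<open>p ^ K\<close>.\<close>

lemma quad_step_identity:
  fixes p a u v w z :: "'a::field"
  assumes uv: "u * v = p"
  shows "(1 - z ^ 2 * p ^ 2) * ((1 - a * p * u * z ^ 2) * (1 - a * p * v * z ^ 2)) * w * (1 - a * (z * p ^ 3) * w)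
     + (1 - a * (z ^ 3 * p ^ 3)) * (z ^ 2 * (w * p ^ 2 - 1)) * ((1 - a * p * u * w) * (1 - a * p * v * w))
     - (1 - a * (z ^ 3 * p ^ 3)) * (w - z ^ 2) * ((1 - a * (z * p ^ 2) * w) * (1 - a * (z * p ^ 3) * w))
     = (1 - a * (z * p)) * ((1 - u * (z * p)) * (1 - v * (z * p))) * (a * (z * p ^ 2)) * w * (w - z ^ 2)"
proof -
  \<comment> \<open>\<open>u\<close> and \<open>v\<close> enter only through \<open>u + v\<close>
    and \<open>u * v = p\<close>, so both are eliminated in favour of \<open>s\<close> and
    \<open>p\<close>.\<close>
  define s where "s = u + v"
  have *: "(1 - c * u * y) * (1 - c * v * y) = 1 - c * s * y + c * c * p * y * y" for c y
    unfolding uv[symmetric] s_def by (simp add: algebra_simps)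
  have **: "(1 - u * y) * (1 - v * y) = 1 - s * y + p * y * y" for y
    unfolding uv[symmetric] s_def by (simp add: algebra_simps)
  show ?thesis
    unfolding * ** by algebra
qed

text \<open>The certificate on the right is forced: dividing out the common factors, both sides are linear in
  \<open>w\<close>, and evaluation at \<open>w = p\<^sup>2\<^sup>K\<close> isolates its value.\<close>
lemma quad_num_shift_partial:
  fixes p a u v w :: "'a::field"
  assumes uv: "u * v = p"
    and p_ne: "\<And>j. j < M \<Longrightarrow> 1 - p ^ (2 * j + 2) \<noteq> 0"
    and u_ne: "\<And>j. j < M \<Longrightarrow> 1 - a * p * u * p ^ (2 * j) \<noteq> 0"
    and v_ne: "\<And>j. j < M \<Longrightarrow> 1 - a * p * v * p ^ (2 * j) \<noteq> 0"
    and "K \<le> M"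
  defines "f \<equiv> \<lambda>k w. (1 - a * p ^ (3 * k)) * quad_coef p a u v k
     * (\<Prod>j<k. w - p ^ (2 * j)) * (\<Prod>i=k..<M. 1 - a * p ^ (i + 1) * w)"
  shows "(\<Sum>k\<le>K. f k (w * p ^ 2) * ((1 - a * p * u * w) * (1 - a * p * v * w))
            - f k w * ((1 - a * p ^ (M + 1) * w) * (1 - a * p ^ (M + 2) * w)))
       = quad_coef p a u v K * ((1 - a * p ^ K) * ((1 - u * p ^ K) * (1 - v * p ^ K)) * (a * p ^ (K + 1)))
         * w * (\<Prod>j<K. w - p ^ (2 * j)) * (\<Prod>i=K+2..<M+2. 1 - a * p ^ (i + 1) * w)"
proof -
  \<comment> \<open>Passing from \<open>w\<close> to \<open>w * p ^ 2\<close> shifts the index of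
    \<open>e\<close> by two, turning \<open>k..<M\<close> into \<open>k+2..<M+2\<close>; the
    multiplier \<open>e M * e (M + 1)\<close> brings the unshifted product to the same upper
    end.\<close>
  define e where "e = (\<lambda>i. 1 - a * p ^ (i + 1) * w)"
  have e_shift: "1 - a * p ^ (i + 1) * (w * p ^ 2) = e (i + 2)" for i
    by (simp add: e_def algebra_simps power2_eq_square)
  have e_eq: "1 - a * p ^ (i + 1) * w = e i" for i
    by (simp add: e_def)
  have e_M: "e M * e (M + 1) = (1 - a * p ^ (M + 1) * w) * (1 - a * p ^ (M + 2) * w)"
    by (simp add: e_def)
  show ?thesis
    using \<open>K \<le> M\<close>
  proof (induction K)
    case 0
    define E where "E = (\<Prod>i=2..<M+2. e i)"
    have sh: "(\<Prod>i=0..<M. 1 - a * p ^ (i + 1) * (w * p ^ 2)) = E"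
      unfolding e_shift prod_ivl_shift2 E_def add_0 ..
    have ful: "(\<Prod>i=0..<M. 1 - a * p ^ (i + 1) * w) * (e M * e (M + 1)) = e 0 * (e 1 * E)"
      unfolding e_eq prod_ivl_snoc2[OF le0] E_def
      by (simp only: prod.atLeast_Suc_lessThan[of 0 "Suc (Suc M)"] prod.atLeast_Suc_lessThan[of "Suc 0" "Suc (Suc M)"]
          numeral_2_eq_2 One_nat_def add_Suc_right zero_less_Suc Suc_less_eq add_0_right)
    have f1: "f 0 (w * p ^ 2) = (1 - a) * E"
      unfolding f_def quad_coef_def using sh by simp
    have f2: "f 0 w * (e M * e (M + 1)) = (1 - a) * (e 0 * (e 1 * E))"
      unfolding f_def quad_coef_def ful[symmetric] by simp
    have e01: "e 0 = 1 - a * p * w" "e 1 = 1 - a * p ^ 2 * w"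
      by (simp_all add: e_def power2_eq_square)
    have "(1 - a) * E * ((1 - a * p * u * w) * (1 - a * p * v * w))
        - (1 - a) * ((1 - a * p * w) * ((1 - a * p ^ 2 * w) * E))
        = (1 - a) * ((1 - u) * (1 - v)) * (a * p) * w * E"
      unfolding uv[symmetric] by (simp add: algebra_simps power2_eq_square)
    moreover have "(\<Prod>i=0+2..<M+2. 1 - a * p ^ (i + 1) * w) = E"
      by (simp only: E_def e_def add_0)
    ultimately show ?case
      unfolding e_M[symmetric] atMost_0 by (simp add: f1 f2[unfolded e01, simplified] quad_coef_def)
  next
    case (Suc K)
    let ?k = "Suc K"
    define E where "E = (\<Prod>i=K+3..<M+2. e i)"
    define A where "A = (\<Prod>j<K. w - p ^ (2 * j))"
    define c where "c = quad_coef p a u v (Suc K)"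
    define z where "z = p ^ K"
    have K: "K < M" using Suc.prems by simp
    have h2: "p ^ (2 * K) = z ^ 2" and h3: "p ^ (3 * K) = z ^ 3"
      unfolding z_def power_mult[symmetric] by (simp_all only: mult.commute)
    have pw: "p ^ (2 * K) = z ^ 2" "p ^ (3 * Suc K) = z ^ 3 * p ^ 3" "p ^ Suc K = z * p"
      "p ^ (Suc K + 1) = z * p ^ 2" "p ^ (K + 1) = z * p" "p ^ (2 * K + 2) = z ^ 2 * p ^ 2" "p ^ K = z"
      using h2 h3 by (simp_all add: z_def power_add power2_eq_square power3_eq_cube)
    have e12: "e (K + 1) = 1 - a * (z * p ^ 2) * w" "e (K + 2) = 1 - a * (z * p ^ 3) * w"
      by (simp_all add: e_def z_def algebra_simps power2_eq_square power3_eq_cube)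
    have sh: "(\<Prod>i=?k..<M. 1 - a * p ^ (i + 1) * (w * p ^ 2)) = E"
      unfolding e_shift prod_ivl_shift2 E_def by (simp add: numeral_3_eq_3)
    have E1: "(\<Prod>i=K+2..<M+2. e i) = e (K + 2) * E"
      unfolding E_def using K by (subst prod.atLeast_Suc_lessThan) (simp_all add: numeral_3_eq_3)
    have E2: "(\<Prod>i=?k..<M. 1 - a * p ^ (i + 1) * w) * (e M * e (M + 1)) = e (K + 1) * (e (K + 2) * E)"
      unfolding e_eq prod_ivl_snoc2[OF Suc.prems] E1[symmetric]
      using K by (subst prod.atLeast_Suc_lessThan) simp_all
    have c: "quad_coef p a u v K * ((1 - a * z) * ((1 - u * z) * (1 - v * z)) * (a * (z * p)))
        = c * ((1 - z ^ 2 * p ^ 2) * ((1 - a * p * u * z ^ 2) * (1 - a * p * v * z ^ 2)))"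
      using p_ne[OF K] u_ne[OF K] v_ne[OF K] unfolding c_def quad_coef_def pw prod.lessThan_Suc
      by simp
    have f1: "f ?k (w * p ^ 2) = (1 - a * (z ^ 3 * p ^ 3)) * c * (z ^ 2 * (w * p ^ 2 - 1) * A) * E"
      unfolding f_def sh prod_shift_two pw c_def A_def by simp
    have f2: "f ?k w * (e M * e (M + 1))
        = (1 - a * (z ^ 3 * p ^ 3)) * c * (A * (w - z ^ 2)) * (e (K + 1) * (e (K + 2) * E))"
      unfolding E2[symmetric] f_def prod.lessThan_Suc pw c_def A_def by (simp add: mult.assoc)
    have key: "(1 - z ^ 2 * p ^ 2) * ((1 - a * p * u * z ^ 2) * (1 - a * p * v * z ^ 2)) * w * (1 - a * (z * p ^ 3) * w)
       + (1 - a * (z ^ 3 * p ^ 3)) * (z ^ 2 * (w * p ^ 2 - 1)) * ((1 - a * p * u * w) * (1 - a * p * v * w))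
       - (1 - a * (z ^ 3 * p ^ 3)) * (w - z ^ 2) * ((1 - a * (z * p ^ 2) * w) * (1 - a * (z * p ^ 3) * w))
       = (1 - a * (z * p)) * ((1 - u * (z * p)) * (1 - v * (z * p))) * (a * (z * p ^ 2)) * w * (w - z ^ 2)"
      by (rule quad_step_identity[OF uv])
    \<comment> \<open>The bracket identity \<open>key\<close> times the common factor
      \<open>c * A * E\<close>.\<close>
    have gen: "c * X1 * w * A * (Y * E) + (X2 * c * (X3 * A) * E * X4 - X2 * c * (A * X5) * (X6 * (Y * E)))
        = c * X7 * w * (A * X5) * E"
      if "X1 * w * Y + X2 * X3 * X4 - X2 * X5 * (X6 * Y) = X7 * w * X5" for X1 X2 X3 X4 X5 X6 X7 Y
      using arg_cong[OF that, of "\<lambda>t. c * A * E * t"] by (simp add: algebra_simps)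
    have E3: "(\<Prod>i=Suc K + 2..<M+2. 1 - a * p ^ (i + 1) * w) = E"
      by (simp add: E_def e_def numeral_3_eq_3)
    have IH: "(\<Sum>k\<le>K. f k (w * p ^ 2) * ((1 - a * p * u * w) * (1 - a * p * v * w)) - f k w * (e M * e (M + 1)))
       = c * ((1 - z ^ 2 * p ^ 2) * ((1 - a * p * u * z ^ 2) * (1 - a * p * v * z ^ 2))) * w * A * (e (K + 2) * E)"
      using Suc.IH[OF less_imp_le[OF K]] unfolding e_M c[symmetric] E1[symmetric] A_def
      unfolding e_def pw by (simp only:)
    show ?case
      unfolding e_M[symmetric] sum.atMost_Suc IH f1 f2 E3 prod.lessThan_Suc pw A_def[symmetric] c_def[symmetric] e12
      by (rule gen[OF key])
  qed
qed

text \<open>At \<open>K = M\<close> the partial sum is complete and its certificate contains the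
  product assumed to vanish. So the sum may terminate through \<open>a\<close>, \<open>u\<close> or
  \<open>v\<close>, or because \<open>w\<close> is one of the first \<open>M\<close> powers of
  \<open>p ^ 2\<close>.\<close>

lemma quad_num_shift:
  fixes p a u v w :: "'a::field"
  assumes uv: "u * v = p"
    and p_ne: "\<And>j. j < M \<Longrightarrow> 1 - p ^ (2 * j + 2) \<noteq> 0"
    and u_ne: "\<And>j. j < M \<Longrightarrow> 1 - a * p * u * p ^ (2 * j) \<noteq> 0"
    and v_ne: "\<And>j. j < M \<Longrightarrow> 1 - a * p * v * p ^ (2 * j) \<noteq> 0"
    and vanish: "(1 - a * p ^ M) * ((1 - u * p ^ M) * (1 - v * p ^ M)) * (\<Prod>j<M. w - p ^ (2 * j)) = 0"
  shows "quad_num p a u v M (w * p ^ 2) * ((1 - a * p * u * w) * (1 - a * p * v * w))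
       = quad_num p a u v M w * ((1 - a * p ^ (M + 1) * w) * (1 - a * p ^ (M + 2) * w))"
proof -
  have "quad_num p a u v M (w * p ^ 2) * ((1 - a * p * u * w) * (1 - a * p * v * w))
       - quad_num p a u v M w * ((1 - a * p ^ (M + 1) * w) * (1 - a * p ^ (M + 2) * w)) = 0"
    unfolding quad_num_def sum_distrib_right sum_subtractf[symmetric]
    by (subst quad_num_shift_partial[OF uv p_ne u_ne v_ne order_refl]) (use vanish in auto)
  then show ?thesis by simp
qed

lemma quad_num_at_one: "quad_num p a u v M 1 = (1 - a) * (\<Prod>i<M. 1 - a * p ^ (i + 1))"
proof -
  have "quad_num p a u v M 1 = (\<Sum>k\<le>M. if k = 0 then (1 - a) * (\<Prod>i<M. 1 - a * p ^ (i + 1)) else 0)"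
    unfolding quad_num_def
  proof (intro sum.cong refl)
    fix k
    have "(\<Prod>j<k. 1 - p ^ (2 * j)) = 0" if "k > 0"
      using that by (intro prod_zero bexI[of _ 0]) auto
    then show "(1 - a * p ^ (3 * k)) * quad_coef p a u v k * (\<Prod>j<k. 1 - p ^ (2 * j))
        * (\<Prod>i=k..<M. 1 - a * p ^ (i + 1) * 1) = (if k = 0 then (1 - a) * (\<Prod>i<M. 1 - a * p ^ (i + 1)) else 0)"
      by (auto simp: quad_coef_def atLeast0LessThan)
  qed
  then show ?thesis by simp
qed

section \<open>Closed forms by interpolation in \<open>w\<close>\<close>

definition quad_poly :: "'a::field \<Rightarrow> 'a \<Rightarrow> 'a \<Rightarrow> 'a \<Rightarrow> nat \<Rightarrow> 'a poly" where
  "quad_poly p a u v M = (\<Sum>k\<le>M. smult ((1 - a * p ^ (3 * k)) * quad_coef p a u v k)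
     ((\<Prod>j<k. [:- (p ^ (2 * j)), 1:]) * (\<Prod>i=k..<M. [:1, - (a * p ^ (i + 1)):])))"

lemma poly_quad_poly: "poly (quad_poly p a u v M) w = quad_num p a u v M w"
  unfolding quad_poly_def quad_num_def
  by (simp add: poly_sum poly_prod mult.assoc) (simp add: mult_ac)

lemma poly_eq_if_agree_powers:
  fixes P Q :: "'a::field poly"
  assumes inj: "inj (\<lambda>j::nat. s ^ j)" and "\<And>j. poly P (s ^ j) = poly Q (s ^ j)"
  shows "P = Q"
proof -
  have "infinite (range (\<lambda>j::nat. s ^ j))"
    using inj by (simp add: finite_image_iff)
  moreover have "range (\<lambda>j::nat. s ^ j) \<subseteq> {x. poly (P - Q) x = 0}"
    using assms(2) by auto
  ultimately have "P - Q = 0"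
    using poly_roots_finite finite_subset by blast
  then show ?thesis by simp
qed

text \<open>At \<open>w = 1\<close> the value contains the factor \<open>1 - a * p ^ M = 0\<close>.
  The shift relation carries this zero to every power of \<open>p ^ 2\<close>, and a polynomial in
  \<open>w\<close> with infinitely many zeros is zero.\<close>

lemma quad_num_eq_zero:
  fixes p a u v w :: "'a::field"
  assumes uv: "u * v = p"
    and inj: "inj (\<lambda>j::nat. (p ^ 2) ^ j)"
    and p_ne: "\<And>j. 1 - p ^ (2 * j + 2) \<noteq> 0"
    and u_ne: "\<And>j. 1 - a * p * u * p ^ (2 * j) \<noteq> 0"
    and v_ne: "\<And>j. 1 - a * p * v * p ^ (2 * j) \<noteq> 0"
    and "M > 0" and a: "a * p ^ M = 1"
  shows "quad_num p a u v M w = 0"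
proof -
  have *: "quad_num p a u v M ((p ^ 2) ^ j) = 0" for j
  proof (induction j)
    case 0
    have "(\<Prod>i<M. 1 - a * p ^ (i + 1)) = 0"
      using \<open>M > 0\<close> a by (intro prod_zero bexI[of _ "M - 1"]) auto
    then show ?case by (simp add: quad_num_at_one)
  next
    case (Suc j)
    have "quad_num p a u v M ((p ^ 2) ^ j * p ^ 2)
        * ((1 - a * p * u * (p ^ 2) ^ j) * (1 - a * p * v * (p ^ 2) ^ j)) = 0"
      using quad_num_shift[OF uv p_ne u_ne v_ne, where w = "(p ^ 2) ^ j" and M = M] a Suc.IH by simp
    then show ?case
      using u_ne[of j] v_ne[of j] unfolding power_mult power_Suc2 by simp
  qed
  have "quad_poly p a u v M = 0"
    using poly_eq_if_agree_powers[OF inj, of "quad_poly p a u v M" 0] * by (simp add: poly_quad_poly)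
  then show ?thesis by (metis poly_quad_poly poly_0)
qed

text \<open>\<open>H\<close> satisfies the same first order recurrence under
  \<open>w \<mapsto> w * p ^ 2\<close> as the sum, so the two polynomials are proportional. The
  cross-multiplied form also covers \<open>H 1 = 0\<close>.\<close>

lemma quad_num_factor:
  fixes p a u v w :: "'a::field"
  assumes uv: "u * v = p"
    and inj: "inj (\<lambda>j::nat. (p ^ 2) ^ j)"
    and p_ne: "\<And>j. 1 - p ^ (2 * j + 2) \<noteq> 0"
    and u_ne: "\<And>j. 1 - a * p * u * p ^ (2 * j) \<noteq> 0"
    and v_ne: "\<And>j. 1 - a * p * v * p ^ (2 * j) \<noteq> 0"
    and u: "u * p ^ (2 * m) = 1" and p0: "p \<noteq> 0"
  defines "H \<equiv> \<lambda>w. \<Prod>i<m. (1 - a * w / p ^ (2 * i + 1)) * (1 - a * w * p ^ (2 * i + 1))"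
  shows "quad_num p a u v (2 * m) w * H 1 = quad_num p a u v (2 * m) 1 * H w"
proof -
  let ?P = "quad_num p a u v (2 * m)"
  have v: "v = p ^ (2 * m + 1)"
  proof -
    have "v = (u * p ^ (2 * m)) * v" using u by simp
    also have "\<dots> = p ^ (2 * m + 1)" using uv by (simp add: mult_ac)
    finally show ?thesis .
  qed
  have H: "H (w * p ^ 2) * (1 - a * p * u * w) = H w * (1 - a * p ^ (2 * m + 1) * w)" for w
  proof -
    \<comment> \<open>The telescoping is proved for any number \<open>k\<close> of factors; at
      \<open>k = m\<close> the extra factor on the left is \<open>1 - a * p * u * w\<close>, because
      \<open>u\<close> is the inverse of \<open>p ^ (2 * m)\<close>.\<close>
    have "(\<Prod>i<k. (1 - a * (w * p ^ 2) / p ^ (2 * i + 1)) * (1 - a * (w * p ^ 2) * p ^ (2 * i + 1)))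
          * (1 - a * w * p / p ^ (2 * k))
        = (\<Prod>i<k. (1 - a * w / p ^ (2 * i + 1)) * (1 - a * w * p ^ (2 * i + 1)))
          * (1 - a * p ^ (2 * k + 1) * w)" for k
    proof (induction k)
      case (Suc k)
      let ?L = "\<Prod>i<k. (1 - a * (w * p ^ 2) / p ^ (2 * i + 1)) * (1 - a * (w * p ^ 2) * p ^ (2 * i + 1))"
      let ?R = "\<Prod>i<k. (1 - a * w / p ^ (2 * i + 1)) * (1 - a * w * p ^ (2 * i + 1))"
      have e1: "a * (w * p ^ 2) / p ^ (2 * k + 1) = a * w * p / p ^ (2 * k)"
        using p0 by (simp add: field_simps power2_eq_square)
      have e2: "a * w * p / p ^ (2 * Suc k) = a * w / p ^ (2 * k + 1)"
        using p0 by (simp add: field_simps power2_eq_square)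
      have e3: "a * (w * p ^ 2) * p ^ (2 * k + 1) = a * p ^ (2 * Suc k + 1) * w"
        by (simp add: algebra_simps power2_eq_square)
      have e4: "a * w * p ^ (2 * k + 1) = a * p ^ (2 * k + 1) * w"
        by simp
      have gen: "L * (X * Y) * Z = R * (Z * W) * Y" if "L * X = R * W" for L R X Y Z W :: 'a
        using that by algebra
      show ?case
        unfolding prod.lessThan_Suc e1 e2 e3 e4 by (rule gen[OF Suc.IH])
    qed simp
    note this[of m]
    moreover have "a * w * p / p ^ (2 * m) = a * p * u * w"
      using u p0 by (simp add: field_simps)
    ultimately show ?thesis
      unfolding H_def by (simp only:)
  qed
  have *: "?P ((p ^ 2) ^ j) * H 1 = ?P 1 * H ((p ^ 2) ^ j)" for j
  proof (induction j)
    case (Suc j)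
    let ?w = "(p ^ 2) ^ j"
    let ?D = "(1 - a * p * u * ?w) * (1 - a * p * v * ?w)"
    have sh: "?P (?w * p ^ 2) * ?D = ?P ?w * ((1 - a * p ^ (2 * m + 1) * ?w) * (1 - a * p ^ (2 * m + 2) * ?w))"
      using quad_num_shift[OF uv p_ne u_ne v_ne, where w = ?w and M = "2 * m"] u by simp
    have D: "?D \<noteq> 0"
      using u_ne[of j] v_ne[of j] unfolding power_mult by simp
    \<comment> \<open>Thus \<open>1 - a * p * v * w\<close> cancels the second factor on the right
      of the shift relation, which leaves exactly the recurrence of \<open>H\<close>.\<close>
    have v2: "a * p * v = a * p ^ (2 * m + 2)"
      using v by simp
    have "(?P (?w * p ^ 2) * H 1) * ?D = (?P (?w * p ^ 2) * ?D) * H 1"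
      by (simp only: mult_ac)
    also have "\<dots> = (?P ?w * H 1) * ((1 - a * p ^ (2 * m + 1) * ?w) * (1 - a * p ^ (2 * m + 2) * ?w))"
      unfolding sh by (simp only: mult_ac)
    also have "\<dots> = ?P 1 * (H ?w * (1 - a * p ^ (2 * m + 1) * ?w)) * (1 - a * p ^ (2 * m + 2) * ?w)"
      unfolding Suc.IH by (simp only: mult_ac)
    also have "\<dots> = (?P 1 * H (?w * p ^ 2)) * ?D"
      unfolding H[symmetric] v2 by (simp only: mult_ac)
    finally show ?case using D unfolding power_Suc2 by simp
  qed simp
  define HP where "HP = (\<Prod>i<m. [:1, - (a / p ^ (2 * i + 1)):] * [:1, - (a * p ^ (2 * i + 1)):])"
  have HP: "poly HP w = H w" for w
    unfolding HP_def H_def poly_prod poly_mult by (intro prod.cong) (simp_all add: mult_ac)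
  have "smult (H 1) (quad_poly p a u v (2 * m)) = smult (?P 1) HP"
    using * by (intro poly_eq_if_agree_powers[OF inj]) (simp add: poly_quad_poly HP mult.commute)
  then have "poly (smult (H 1) (quad_poly p a u v (2 * m))) w = poly (smult (?P 1) HP) w"
    by simp
  then show ?thesis by (simp add: poly_quad_poly HP mult.commute)
qed

text \<open>Starting from \<open>1 - a\<close> at \<open>w = 1\<close>, the shift relation is
  applied \<open>m\<close> times. Each starting point is \<open>p ^ (2 * j)\<close> with
  \<open>j < M\<close>, so the sum terminates through \<open>w\<close> and \<open>a\<close>,
  \<open>u\<close>, \<open>v\<close> stay free.\<close>

lemma quad_sum_at_power:
  fixes p a u v :: "'a::field"
  assumes uv: "u * v = p"
    and p_ne: "\<And>j. j < M \<Longrightarrow> 1 - p ^ (2 * j + 2) \<noteq> 0"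
    and u_ne: "\<And>j. j < M \<Longrightarrow> 1 - a * p * u * p ^ (2 * j) \<noteq> 0"
    and v_ne: "\<And>j. j < M \<Longrightarrow> 1 - a * p * v * p ^ (2 * j) \<noteq> 0"
    and a_ne: "\<And>j. 1 - a * p ^ (j + 1) \<noteq> 0"
    and "m \<le> M"
  shows "quad_sum p a u v M (p ^ (2 * m)) = (1 - a) * (\<Prod>j<m. (1 - a * p ^ (2 * j + 1)) * (1 - a * p ^ (2 * j + 2))
     / ((1 - a * p * u * p ^ (2 * j)) * (1 - a * p * v * p ^ (2 * j))))"
proof -
  define E where "E = (\<lambda>j. \<Prod>i<M. 1 - a * p ^ (i + 1) * p ^ (2 * j))"
  have ne: "1 - a * p ^ (i + 1) * p ^ j \<noteq> 0" for i j
    using a_ne[of "i + j"] by (simp add: power_add mult_ac)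
  have E_ne: "E j \<noteq> 0" for j
    unfolding E_def prod_zero_iff[OF finite_lessThan] using ne by blast
  have S: "quad_sum p a u v M (p ^ (2 * j)) = quad_num p a u v M (p ^ (2 * j)) / E j" for j
    unfolding E_def by (rule quad_sum_eq_num) (rule ne)
  have E_Suc: "E (Suc j) * ((1 - a * p ^ (2 * j + 1)) * (1 - a * p ^ (2 * j + 2)))
      = E j * ((1 - a * p ^ (M + 1) * p ^ (2 * j)) * (1 - a * p ^ (M + 2) * p ^ (2 * j)))" for j
  proof -
    let ?g = "\<lambda>i. 1 - a * p ^ (i + 1) * p ^ (2 * j)"
    have "(\<Prod>i<Suc (Suc M). ?g i) = E j * (?g M * ?g (M + 1))"
      by (simp add: E_def mult.assoc)
    moreover have "(\<Prod>i<Suc (Suc M). ?g i) = ?g 0 * ?g 1 * (\<Prod>i<M. ?g (Suc (Suc i)))"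
      unfolding prod.lessThan_Suc_shift by (simp only: mult.assoc One_nat_def)
    moreover have "(\<Prod>i<M. ?g (Suc (Suc i))) = E (Suc j)"
      unfolding E_def by (intro prod.cong) (simp_all add: algebra_simps)
    ultimately have "?g 0 * ?g 1 * E (Suc j) = E j * (?g M * ?g (M + 1))"
      by (simp only:)
    moreover have "?g 0 = 1 - a * p ^ (2 * j + 1)" "?g 1 = 1 - a * p ^ (2 * j + 2)"
      by (simp_all add: algebra_simps)
    ultimately show ?thesis by (simp add: mult_ac)
  qed
  show ?thesis
    using \<open>m \<le> M\<close>
  proof (induction m)
    case 0
    have "quad_sum p a u v M (p ^ (2 * 0)) = quad_num p a u v M 1 / E 0"
      unfolding S by simp
    also have "\<dots> = 1 - a"
      using E_ne[of 0] unfolding quad_num_at_one by (simp add: E_def)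
    finally show ?case by simp
  next
    case (Suc m)
    let ?w = "p ^ (2 * m)"
    have z: "(\<Prod>j<M. ?w - p ^ (2 * j)) = 0"
      using Suc.prems by (intro prod_zero bexI[of _ m]) auto
    have w2: "p ^ (2 * Suc m) = ?w * p ^ 2"
      by (simp add: power2_eq_square)
    let ?D = "(1 - a * p * u * ?w) * (1 - a * p * v * ?w)"
    let ?F = "(1 - a * p ^ (M + 1) * ?w) * (1 - a * p ^ (M + 2) * ?w)"
    let ?G = "(1 - a * p ^ (2 * m + 1)) * (1 - a * p ^ (2 * m + 2))"
    have sh: "quad_num p a u v M (p ^ (2 * Suc m)) * ?D = quad_num p a u v M ?w * ?F"
      unfolding w2 by (rule quad_num_shift[OF uv p_ne u_ne v_ne]) (use z in auto)
    have D: "?D \<noteq> 0"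
      using u_ne[of m] v_ne[of m] Suc.prems by simp
    have F: "?F \<noteq> 0"
      using ne[of M "2*m"] ne[of "M+1" "2*m"] by simp
    have "quad_sum p a u v M (p ^ (2 * Suc m)) = quad_num p a u v M (p ^ (2 * Suc m)) / E (Suc m)"
      by (rule S)
    also have "\<dots> = quad_num p a u v M ?w / E m * (?G / ?D)"
    proof -
      \<comment> \<open>Eliminates the old numerator and denominator; the spurious factor
        \<open>F\<close> is nonzero and is cancelled next.\<close>
      have gen: "N' * (E0 * D) * F = N0 * G * E1 * F" if "N' * D = N0 * F" "E1 * G = E0 * F"
        for N' N0 E0 E1 D F G :: 'a
        using that by algebra
      have "quad_num p a u v M (p ^ (2 * Suc m)) * (E m * ?D) * ?F = quad_num p a u v M ?w * ?G * E (Suc m) * ?F"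
        using gen[OF sh E_Suc[of m]] .
      then have "quad_num p a u v M (p ^ (2 * Suc m)) * (E m * ?D) = quad_num p a u v M ?w * ?G * E (Suc m)"
        using F by simp
      then show ?thesis
        unfolding times_divide_times_eq
        by (subst frac_eq_eq) (use E_ne[of m] E_ne[of "Suc m"] D in simp_all)
    qed
    also have "\<dots> = quad_sum p a u v M ?w * (?G / ?D)"
      unfolding S ..
    finally show ?case
      using Suc by (simp add: mult.assoc)
  qed
qed

section \<open>Order of vanishing of rational functions at a point\<close>

text \<open>A relation rather than a function, so that regularity at \<open>z\<close> and the value
  there are carried together. The fraction need not be in lowest terms.\<close>

definition has_value :: "complex \<Rightarrow> ratfun \<Rightarrow> complex \<Rightarrow> bool" where
  "has_value z f c \<longleftrightarrow> (\<exists>A E. poly E z \<noteq> 0 \<and> f = to_fract A / to_fract E \<and> c = poly A z / poly E z)"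

lemma has_value_unique:
  assumes "has_value z f c" "has_value z f c'"
  shows "c = c'"
proof -
  obtain A E where A: "poly E z \<noteq> 0" "f = to_fract A / to_fract E" "c = poly A z / poly E z"
    using assms(1) unfolding has_value_def by blast
  obtain A' E' where A': "poly E' z \<noteq> 0" "f = to_fract A' / to_fract E'" "c' = poly A' z / poly E' z"
    using assms(2) unfolding has_value_def by blast
  have "E \<noteq> 0" "E' \<noteq> 0" using A(1) A'(1) by auto
  then have "to_fract (A * E') = to_fract (A' * E)"
    using A(2) A'(2) by (simp add: frac_eq_eq)
  then have "A * E' = A' * E" by (simp only: to_fract_eq_iff)
  then have "poly A z * poly E' z = poly A' z * poly E z" by (metis poly_mult)
  then show ?thesis using A A' by (simp add: frac_eq_eq)
qed

lemma has_value_to_fract: "has_value z (to_fract A) (poly A z)"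
  unfolding has_value_def by (rule exI[of _ A], rule exI[of _ 1]) simp

lemma has_value_0 [simp]: "has_value z 0 0"
  using has_value_to_fract[of z 0] by simp

lemma has_value_1 [simp]: "has_value z 1 1"
  using has_value_to_fract[of z 1] by simp

lemma has_value_qvar: "has_value z qvar z"
  using has_value_to_fract[of z "[:0, 1:]"] by (simp add: qvar_def)

lemma has_value_add:
  assumes "has_value z f c" "has_value z g d"
  shows "has_value z (f + g) (c + d)"
proof -
  obtain A E where A: "poly E z \<noteq> 0" "f = to_fract A / to_fract E" "c = poly A z / poly E z"
    using assms(1) unfolding has_value_def by blast
  obtain A' E' where A': "poly E' z \<noteq> 0" "g = to_fract A' / to_fract E'" "d = poly A' z / poly E' z"
    using assms(2) unfolding has_value_def by blast
  have "E \<noteq> 0" "E' \<noteq> 0" using A(1) A'(1) by auto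
  then have "f + g = to_fract (A * E' + A' * E) / to_fract (E * E')"
    unfolding A(2) A'(2) by (simp add: add_frac_eq)
  moreover have "c + d = poly (A * E' + A' * E) z / poly (E * E') z"
    using A A' by (simp add: add_frac_eq)
  ultimately show ?thesis
    unfolding has_value_def using A(1) A'(1)
    by (intro exI[of _ "A * E' + A' * E"] exI[of _ "E * E'"]) auto
qed

lemma has_value_mult:
  assumes "has_value z f c" "has_value z g d"
  shows "has_value z (f * g) (c * d)"
proof -
  obtain A E where A: "poly E z \<noteq> 0" "f = to_fract A / to_fract E" "c = poly A z / poly E z"
    using assms(1) unfolding has_value_def by blast
  obtain A' E' where A': "poly E' z \<noteq> 0" "g = to_fract A' / to_fract E'" "d = poly A' z / poly E' z"
    using assms(2) unfolding has_value_def by blast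
  have "f * g = to_fract (A * A') / to_fract (E * E')"
    unfolding A(2) A'(2) by simp
  moreover have "c * d = poly (A * A') z / poly (E * E') z"
    using A A' by simp
  ultimately show ?thesis
    unfolding has_value_def using A(1) A'(1)
    by (intro exI[of _ "A * A'"] exI[of _ "E * E'"]) auto
qed

lemma has_value_minus: "has_value z f c \<Longrightarrow> has_value z (- f) (- c)"
  using has_value_mult[OF has_value_to_fract[of z "-1"], of f c] by simp

lemma has_value_diff: "has_value z f c \<Longrightarrow> has_value z g d \<Longrightarrow> has_value z (f - g) (c - d)"
  using has_value_add[of z f c "- g" "- d"] has_value_minus by simp

lemma has_value_inverse:
  assumes "has_value z f c" "c \<noteq> 0"
  shows "has_value z (inverse f) (inverse c)"
proof -
  obtain A E where A: "poly E z \<noteq> 0" "f = to_fract A / to_fract E" "c = poly A z / poly E z"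
    using assms(1) unfolding has_value_def by blast
  then show ?thesis
    unfolding has_value_def using assms(2) by (intro exI[of _ E] exI[of _ A]) auto
qed

lemma has_value_divide:
  "has_value z f c \<Longrightarrow> has_value z g d \<Longrightarrow> d \<noteq> 0 \<Longrightarrow> has_value z (f / g) (c / d)"
  using has_value_mult[OF _ has_value_inverse] by (simp add: divide_inverse)

lemma has_value_power: "has_value z f c \<Longrightarrow> has_value z (f ^ k) (c ^ k)"
  by (induction k) (simp_all add: has_value_mult)

lemma has_value_sum: "(\<And>i. i \<in> I \<Longrightarrow> has_value z (f i) (c i)) \<Longrightarrow> has_value z (sum f I) (sum c I)"
  by (induction I rule: infinite_finite_induct) (simp_all add: has_value_add)

lemma has_value_prod: "(\<And>i. i \<in> I \<Longrightarrow> has_value z (f i) (c i)) \<Longrightarrow> has_value z (prod f I) (prod c I)"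
  by (induction I rule: infinite_finite_induct) (simp_all add: has_value_mult)

lemma has_value_of_nat: "has_value z (of_nat k) (of_nat k)"
  by (induction k) (simp_all add: has_value_add)

lemma has_value_numeral: "has_value z (numeral k) (numeral k)"
  using has_value_of_nat[of z "numeral k"] by simp

lemma has_value_nonzero: "has_value z f c \<Longrightarrow> c \<noteq> 0 \<Longrightarrow> f \<noteq> 0"
  using has_value_unique[of z f c 0] by auto

lemmas has_value_intros = has_value_add has_value_mult has_value_minus has_value_diff has_value_divide
  has_value_power has_value_sum has_value_prod has_value_0 has_value_1 has_value_of_nat has_value_numeral
  has_value_qvar

text \<open>A lower bound for the valuation at \<open>z\<close>. Order 0 means regularity at
  \<open>z\<close>, and the zero function has every order.\<close>

definition ord_ge :: "complex \<Rightarrow> nat \<Rightarrow> ratfun \<Rightarrow> bool" where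
  "ord_ge z k f \<longleftrightarrow> (\<exists>g c. has_value z g c \<and> f = to_fract [:- z, 1:] ^ k * g)"

lemma ord_ge_0_iff: "ord_ge z 0 f \<longleftrightarrow> (\<exists>c. has_value z f c)"
  unfolding ord_ge_def by simp

lemma has_value_imp_ord_ge_0: "has_value z f c \<Longrightarrow> ord_ge z 0 f"
  unfolding ord_ge_0_iff by blast

lemma has_value_0_imp_ord_ge_1:
  assumes "has_value z f 0"
  shows "ord_ge z 1 f"
proof -
  obtain A E where A: "poly E z \<noteq> 0" "f = to_fract A / to_fract E" "0 = poly A z / poly E z"
    using assms unfolding has_value_def by blast
  then have "[:- z, 1:] dvd A" by (simp add: poly_eq_0_iff_dvd)
  then obtain A' where "A = [:- z, 1:] * A'" by (elim dvdE)
  then have "f = to_fract [:- z, 1:] ^ 1 * (to_fract A' / to_fract E)"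
    using A(2) by (simp only: to_fract_mult power_one_right times_divide_eq_right)
  moreover have "has_value z (to_fract A' / to_fract E) (poly A' z / poly E z)"
    using A(1) by (intro has_value_divide has_value_to_fract)
  ultimately show ?thesis unfolding ord_ge_def by blast
qed

lemma ord_ge_add: "ord_ge z k f \<Longrightarrow> ord_ge z k g \<Longrightarrow> ord_ge z k (f + g)"
  unfolding ord_ge_def by (metis distrib_left has_value_add)

lemma ord_ge_mult: "ord_ge z k f \<Longrightarrow> ord_ge z l g \<Longrightarrow> ord_ge z (k + l) (f * g)"
  unfolding ord_ge_def
proof (elim exE conjE)
  fix f' g' c d
  assume "has_value z f' c" "has_value z g' d"
    "f = to_fract [:- z, 1:] ^ k * f'" "g = to_fract [:- z, 1:] ^ l * g'"
  then have "has_value z (f' * g') (c * d)" "f * g = to_fract [:- z, 1:] ^ (k + l) * (f' * g')"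
    by (simp_all add: has_value_mult power_add mult_ac)
  then show "\<exists>h c. has_value z h c \<and> f * g = to_fract [:- z, 1:] ^ (k + l) * h" by blast
qed

lemma ord_ge_minus: "ord_ge z k f \<Longrightarrow> ord_ge z k (- f)"
  unfolding ord_ge_def by (metis has_value_minus mult_minus_right)

lemma ord_ge_diff: "ord_ge z k f \<Longrightarrow> ord_ge z k g \<Longrightarrow> ord_ge z k (f - g)"
  using ord_ge_add[of z k f "- g"] ord_ge_minus by simp

lemma ord_ge_zero [simp]: "ord_ge z k 0"
  unfolding ord_ge_def by (intro exI[of _ 0]) simp

lemma ord_ge_mono:
  assumes "ord_ge z k f" "l \<le> k"
  shows "ord_ge z l f"
proof -
  obtain g c where g: "has_value z g c" "f = to_fract [:- z, 1:] ^ k * g"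
    using assms(1) unfolding ord_ge_def by blast
  have "has_value z (to_fract [:- z, 1:] ^ (k - l) * g) (poly [:- z, 1:] z ^ (k - l) * c)"
    by (intro has_value_mult has_value_power has_value_to_fract g)
  moreover have "f = to_fract [:- z, 1:] ^ l * (to_fract [:- z, 1:] ^ (k - l) * g)"
    using g(2) assms(2) by (simp add: mult.assoc[symmetric] power_add[symmetric])
  ultimately show ?thesis unfolding ord_ge_def by blast
qed

lemma ord_ge_1_imp_has_value_0: "ord_ge z 1 f \<Longrightarrow> has_value z f 0"
  unfolding ord_ge_def
proof (elim exE conjE)
  fix g c
  assume g: "has_value z g c" "f = to_fract [:- z, 1:] ^ 1 * g"
  show "has_value z f 0"
    using has_value_mult[OF has_value_to_fract[of z "[:- z, 1:]"] g(1)] g(2) by simp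
qed

lemma ord_ge_power: "ord_ge z k f \<Longrightarrow> ord_ge z (k * l) (f ^ l)"
proof (induction l)
  case 0
  then show ?case by (auto simp: ord_ge_0_iff intro: has_value_1)
next
  case (Suc l)
  then show ?case using ord_ge_mult[of z k f "k * l" "f ^ l"] by simp
qed

lemma ord_ge_sum: "(\<And>i. i \<in> I \<Longrightarrow> ord_ge z k (f i)) \<Longrightarrow> ord_ge z k (sum f I)"
  by (induction I rule: infinite_finite_induct) (simp_all add: ord_ge_add)

lemma ord_ge_mult_0: "ord_ge z k f \<Longrightarrow> ord_ge z 0 g \<Longrightarrow> ord_ge z k (f * g)"
  using ord_ge_mult[of z k f 0 g] by simp

section \<open>Filtrations and mixed differences over a cube\<close>

text \<open>The abstract laws of \<open>ord_ge\<close> that suffice to pass to functions on an edge.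
  As that passage yields such a filtration again, it can be iterated.\<close>

locale filtration =
  fixes V :: "nat \<Rightarrow> 'a::comm_ring_1 \<Rightarrow> bool"
  assumes add: "V k f \<Longrightarrow> V k g \<Longrightarrow> V k (f + g)"
    and minus: "V k f \<Longrightarrow> V k (- f)"
    and mult: "V k f \<Longrightarrow> V l g \<Longrightarrow> V (k + l) (f * g)"
    and mono: "V k f \<Longrightarrow> l \<le> k \<Longrightarrow> V l f"
    and zero: "V k 0"

lemma filtration_ord_ge: "filtration (ord_ge z)"
  by unfold_locales (auto intro: ord_ge_add ord_ge_mult ord_ge_mono ord_ge_minus)

text \<open>Functions on a two-point set whose increment gains \<open>w\<close> in the filtration; iterating over three
  directions, the last component is the mixed third difference.\<close>
definition edge :: "nat \<Rightarrow> (nat \<Rightarrow> 'a::comm_ring_1 \<Rightarrow> bool) \<Rightarrow> nat \<Rightarrow> (bool \<Rightarrow> 'a) \<Rightarrow> bool" where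
  "edge w V k f \<longleftrightarrow> V k (f False) \<and> V (k + w) (f True - f False)"

text \<open>Closure under products is the discrete Leibniz rule
  \<open>f1 * g1 - f0 * g0 = (f1 - f0) * g1 + f0 * (g1 - g0)\<close>.\<close>

lemma filtration_edge:
  assumes "filtration V"
  shows "filtration (edge w V)"
proof -
  interpret filtration V by fact
  show ?thesis
  proof
    fix k l and f g :: "bool \<Rightarrow> 'a"
    show "edge w V k (f + g)" if "edge w V k f" "edge w V k g"
      using that add[of k "f False" "g False"] add[of "k + w" "f True - f False" "g True - g False"]
      by (simp add: edge_def algebra_simps)
    show "edge w V k (- f)" if "edge w V k f"
      using that minus[of k "f False"] minus[of "k + w" "f True - f False"]
      by (simp add: edge_def algebra_simps)
    show "edge w V (k + l) (f * g)" if "edge w V k f" "edge w V l g"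
    proof -
      have f: "V k (f False)" "V (k + w) (f True - f False)"
        and g: "V l (g False)" "V (l + w) (g True - g False)"
        using that by (auto simp: edge_def)
      have gT: "V l (g True)"
        using add[OF g(1) mono[OF g(2), of l]] by simp
      have "V (k + w + l) ((f True - f False) * g True)" "V (k + (l + w)) (f False * (g True - g False))"
        using mult[OF f(2) gT] mult[OF f(1) g(2)] .
      then have "V (k + l + w) ((f True - f False) * g True + f False * (g True - g False))"
        by (intro add) (simp_all add: add_ac)
      then show ?thesis
        using mult[OF f(1) g(1)] by (simp add: edge_def algebra_simps)
    qed
    show "edge w V l f" if "edge w V k f" "l \<le> k"
      using that mono[of k "f False" l] mono[of "k + w" "f True - f False" "l + w"]
      by (auto simp: edge_def)
    show "edge w V k 0"
      using zero by (simp add: edge_def)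
  qed
qed

text \<open>Uses \<open>1/f1 - 1/f0 = - (f1 - f0) / (f1 * f0)\<close>. The assumption
  \<open>inv\<close> is the corresponding statement one dimension lower, and \<open>U\<close> passes
  down the regularity of the inverse at the individual vertices.\<close>

lemma edge_inverse:
  fixes f g :: "bool \<Rightarrow> 'a::comm_ring_1"
  assumes "filtration V"
    and inv: "\<And>f g. f * g = 1 \<Longrightarrow> V 0 f \<Longrightarrow> U g \<Longrightarrow> V 0 g"
    and fg: "f * g = 1" and f: "edge w V 0 f" and U: "\<And>b. U (g b)"
  shows "edge w V 0 g"
proof -
  interpret filtration V by fact
  have fg': "f b * g b = 1" for b
    using fun_cong[OF fg, of b] by simp
  have f': "V 0 (f False)" "V (0 + w) (f True - f False)"
    using f by (auto simp: edge_def)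
  have "V 0 (f True)"
    using add[OF f'(1) mono[OF f'(2), of 0]] by simp
  then have g: "V 0 (g b)" for b
    using inv[OF fg'[of b] _ U[of b]] f'(1) by (cases b) auto
  have gF: "f True * (g True * g False) = g False"
    by (simp add: mult.assoc[symmetric] fg')
  have gT: "f False * (g True * g False) = g True"
    by (subst mult.commute[of "g True"]) (simp add: mult.assoc[symmetric] fg')
  have "g True - g False = - ((f True - f False) * (g True * g False))"
    using gF gT by (simp add: left_diff_distrib)
  moreover have "V (0 + w) (- ((f True - f False) * (g True * g False)))"
    using minus[OF mult[OF f'(2) mult[OF g[of True] g[of False]]]] by simp
  ultimately show ?thesis
    using g by (simp add: edge_def)
qed

text \<open>The weights 1, 1, 2 belong to the flags \<open>l\<close>, \<open>j\<close>,
  \<open>i\<close>: changing \<open>a\<close> or \<open>w\<close> is a first order change, changing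
  \<open>(u, v)\<close> a second order one. They add up to 4 for the mixed third difference.\<close>

definition cube :: "complex \<Rightarrow> (bool \<Rightarrow> bool \<Rightarrow> bool \<Rightarrow> ratfun) \<Rightarrow> bool" where
  "cube z = edge 1 (edge 1 (edge 2 (ord_ge z))) 0"

lemmas filtration_edges = filtration_edge[OF filtration_edge[OF filtration_edge[OF filtration_ord_ge]]]

lemma cube_add: "cube z f \<Longrightarrow> cube z g \<Longrightarrow> cube z (\<lambda>l j i. f l j i + g l j i)"
  using filtration.add[OF filtration_edges, of 1 1 2 z 0 f g] by (simp add: cube_def plus_fun_def)

lemma cube_mult: "cube z f \<Longrightarrow> cube z g \<Longrightarrow> cube z (\<lambda>l j i. f l j i * g l j i)"
  using filtration.mult[OF filtration_edges, of 1 1 2 z 0 f 0 g] by (simp add: cube_def times_fun_def)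

lemma cube_minus: "cube z f \<Longrightarrow> cube z (\<lambda>l j i. - f l j i)"
  using filtration.minus[OF filtration_edges, of 1 1 2 z 0 f] by (simp add: cube_def fun_Compl_def)

lemma cube_diff: "cube z f \<Longrightarrow> cube z g \<Longrightarrow> cube z (\<lambda>l j i. f l j i - g l j i)"
  using cube_add[OF _ cube_minus, of z f g] by simp

lemma cube_const: "ord_ge z 0 c \<Longrightarrow> cube z (\<lambda>l j i. c)"
  by (simp add: cube_def edge_def)

lemma cube_sum: "(\<And>k. k \<in> I \<Longrightarrow> cube z (f k)) \<Longrightarrow> cube z (\<lambda>l j i. \<Sum>k\<in>I. f k l j i)"
  by (induction I rule: infinite_finite_induct) (simp_all add: cube_add cube_const)

lemma cube_prod: "(\<And>k. k \<in> I \<Longrightarrow> cube z (f k)) \<Longrightarrow> cube z (\<lambda>l j i. \<Prod>k\<in>I. f k l j i)"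
  by (induction I rule: infinite_finite_induct)
    (simp_all add: cube_mult cube_const has_value_imp_ord_ge_0[OF has_value_1])

text \<open>Inversion is lifted through the three directions one at a time; nonzero values at all
  eight vertices make the pointwise inverses regular.\<close>

lemma cube_inverse:
  assumes f: "cube z f" and val: "\<And>l j i. \<exists>c. has_value z (f l j i) c \<and> c \<noteq> 0"
  shows "cube z (\<lambda>l j i. inverse (f l j i))"
proof -
  let ?g = "\<lambda>l j i. inverse (f l j i)"
  have inv: "f * ?g = 1"
  proof (intro ext)
    fix l j i
    obtain c where "has_value z (f l j i) c" "c \<noteq> 0" using val by blast
    then have "f l j i \<noteq> 0" by (rule has_value_nonzero)
    then show "(f * ?g) l j i = 1 l j i" by simp
  qed
  have g: "ord_ge z 0 (?g l j i)" for l j i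
    using val[of l j i] has_value_inverse has_value_imp_ord_ge_0 by blast
  have inv1: "edge 2 (ord_ge z) 0 g" if "f * g = 1" "edge 2 (ord_ge z) 0 f" "\<forall>i. ord_ge z 0 (g i)" for f g
    using edge_inverse[OF filtration_ord_ge, where U = "ord_ge z 0", of z f g 2] that by simp
  have inv2: "edge 1 (edge 2 (ord_ge z)) 0 g" if "f * g = 1" "edge 1 (edge 2 (ord_ge z)) 0 f" "\<forall>j i. ord_ge z 0 (g j i)" for f g
    using edge_inverse[OF filtration_edge[OF filtration_ord_ge], where U = "\<lambda>g. \<forall>i. ord_ge z 0 (g i)", of 2 z f g 1]
      that inv1 by simp
  show ?thesis
    using edge_inverse[OF filtration_edge[OF filtration_edge[OF filtration_ord_ge]],
        where U = "\<lambda>g. \<forall>j i. ord_ge z 0 (g j i)", of 1 2 z f ?g 1] inv inv2 g f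
    unfolding cube_def by simp
qed

lemma cube_divide:
  assumes "cube z f" "cube z g" "\<And>l j i. \<exists>c. has_value z (g l j i) c \<and> c \<noteq> 0"
  shows "cube z (\<lambda>l j i. f l j i / g l j i)"
  using cube_mult[OF assms(1) cube_inverse[OF assms(2,3)]] by (simp add: divide_inverse)

lemma cube_imp_third_difference:
  assumes "cube z f"
  shows "ord_ge z 4 ((f True True True - f False True True - (f True False True - f False False True))
    - (f True True False - f False True False - (f True False False - f False False False)))"
  using assms by (simp add: cube_def edge_def numeral_eq_Suc)

lemma cube_imp_first_difference:
  assumes "cube z f"
  shows "ord_ge z 1 (f True False False - f False False False)"
  using assms by (simp add: cube_def edge_def)

section \<open>The parametrised sum at the vertices of the cube\<close>

lemma qvar_power_inject [simp]: "qvar ^ i = qvar ^ j \<longleftrightarrow> i = j"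
proof
  assume "qvar ^ i = qvar ^ j"
  then have "[:0, 1:] ^ i = ([:0, 1:] ^ j :: complex poly)"
    unfolding qvar_def to_fract_power[symmetric] by (simp only: to_fract_eq_iff)
  then have "degree ([:0, 1:] ^ i :: complex poly) = degree ([:0, 1:] ^ j :: complex poly)"
    by simp
  then show "i = j"
    by (simp add: degree_power_eq)
qed simp

lemma qvar_nonzero [simp]: "qvar \<noteq> 0"
  by (simp add: qvar_def)

lemma one_minus_qvar_power_nonzero [simp]: "i > 0 \<Longrightarrow> 1 - qvar ^ i \<noteq> 0"
  using qvar_power_inject[of 0 i] by auto

lemma one_minus_qvar_nonzero [simp]: "1 - qvar \<noteq> 0"
  using one_minus_qvar_power_nonzero[of 1] by simp

lemma qvar_ne_one [simp]: "qvar \<noteq> 1"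
  using one_minus_qvar_nonzero by auto

lemma qvar_ratio_ne_one: "b \<noteq> e \<Longrightarrow> 1 - qvar ^ b / qvar ^ e \<noteq> 0"
  by (simp add: field_simps)

lemma inj_qvar_sq_sq: "inj (\<lambda>j::nat. ((qvar ^ 2) ^ 2) ^ j)"
  by (rule injI) (simp add: power_mult[symmetric])

text \<open>The flags \<open>l\<close>, \<open>j\<close>, \<open>i\<close> shift \<open>a\<close>, \<open>w\<close> and the pair \<open>(u, v)\<close>, in this order.\<close>
definition vertex :: "nat \<Rightarrow> bool \<Rightarrow> bool \<Rightarrow> bool \<Rightarrow> ratfun" where
  "vertex n l j i =
     quad_sum (qvar ^ 2) (if l then qvar / qvar ^ n else qvar)
       (if i then qvar / qvar ^ n else qvar) (if i then qvar * qvar ^ n else qvar)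
       ((n - 1) div 2) (if j then qvar ^ n / qvar else 1 / qvar)"

text \<open>The summand without its q-integer, as a running product. This form makes it
  multiplicative over blocks of indices.\<close>

definition gterm :: "nat \<Rightarrow> ratfun" where
  "gterm k = (\<Prod>j<k. (1 - qvar ^ (4 * j + 1)) * (1 - qvar ^ (2 * j + 1)) ^ 3 * qvar ^ (2 * j + 2)
     / ((1 - qvar ^ (2 * j + 2)) * (1 - qvar ^ (4 * j + 4)) ^ 3))"

lemma summand_eq_gterm:
  "(qpoch qvar (qvar ^ 4) k * qpoch qvar (qvar ^ 2) k ^ 3)
       / (qpoch (qvar ^ 2) (qvar ^ 2) k * qpoch (qvar ^ 4) (qvar ^ 4) k ^ 3)
       * qvar ^ (k ^ 2 + k) = gterm k"
proof -
  \<comment> \<open>The quadratic exponent is spread over the factors, since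
    \<open>k ^ 2 + k\<close> is the sum of \<open>2 * j + 2\<close> over
    \<open>j < k\<close>.\<close>
  have "qvar ^ (k ^ 2 + k) = (\<Prod>j<k. qvar ^ (2 * j + 2))"
  proof (induction k)
    case (Suc k)
    have "(Suc k) ^ 2 + Suc k = (k ^ 2 + k) + (2 * k + 2)"
      by (simp add: power2_eq_square)
    then show ?case using Suc by (simp only: power_add prod.lessThan_Suc)
  qed simp
  then show ?thesis
    unfolding gterm_def qpoch_def prod_dividef prod.distrib prod_power_distrib
    unfolding power_mult[symmetric] by (simp add: power_add power2_eq_square power4_eq_xxxx mult_ac)
qed

lemma vertex_origin: "vertex n False False False = (\<Sum>k\<le>(n - 1) div 2. (1 - qvar ^ (6 * k + 1)) * gterm k)"
proof -
  have coef: "quad_coef (qvar ^ 2) qvar qvar qvar k * (\<Prod>j<k. 1 / qvar - (qvar ^ 2) ^ (2 * j))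
      / (\<Prod>i<k. 1 - qvar * (qvar ^ 2) ^ (i + 1) * (1 / qvar)) = gterm k" for k
  proof -
    have "(1 - qvar * (qvar ^ 2) ^ j) * ((1 - qvar * (qvar ^ 2) ^ j) * (1 - qvar * (qvar ^ 2) ^ j)) * (qvar * (qvar ^ 2) ^ (j + 1))
     / ((1 - (qvar ^ 2) ^ (2 * j + 2)) * ((1 - qvar * qvar ^ 2 * qvar * (qvar ^ 2) ^ (2 * j)) * (1 - qvar * qvar ^ 2 * qvar * (qvar ^ 2) ^ (2 * j))))
     * (1 / qvar - (qvar ^ 2) ^ (2 * j)) / (1 - qvar * (qvar ^ 2) ^ (j + 1) * (1 / qvar))
     = (1 - qvar ^ (4 * j + 1)) * (1 - qvar ^ (2 * j + 1)) ^ 3 * qvar ^ (2 * j + 2)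
     / ((1 - qvar ^ (2 * j + 2)) * (1 - qvar ^ (4 * j + 4)) ^ 3)" for j
    proof -
      have e: "qvar * (qvar ^ 2) ^ j = qvar ^ (2 * j + 1)" "(qvar ^ 2) ^ (j + 1) = qvar ^ (2 * j + 2)"
        "(qvar ^ 2) ^ (2 * j + 2) = qvar ^ (4 * j + 4)" "qvar * qvar ^ 2 * qvar * (qvar ^ 2) ^ (2 * j) = qvar ^ (4 * j + 4)"
        "qvar * qvar ^ (2 * j + 2) * (1 / qvar) = qvar ^ (2 * j + 2)"
        unfolding power_mult[symmetric] by (simp_all add: power_add power2_eq_square power4_eq_xxxx)
      \<comment> \<open>The factor \<open>q\<close> of \<open>a * p ^ (j + 1)\<close> is absorbed
        here, turning \<open>w - p ^ (2 * j)\<close> with \<open>w = 1 / q\<close> into a factor of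
        the first shifted factorial.\<close>
      have e': "qvar * (1 / qvar - (qvar ^ 2) ^ (2 * j)) = 1 - qvar ^ (4 * j + 1)"
        by (simp add: power_mult[symmetric] right_diff_distrib)
      have "x * x * x * (qvar * y) / (d * (d * d)) * t / g = (qvar * t) * x ^ 3 * y / (g * d ^ 3)" for x y d t g
        by (simp add: power3_eq_cube mult_ac)
      from this[of "1 - qvar ^ (2 * j + 1)" "qvar ^ (2 * j + 2)" "1 - qvar ^ (4 * j + 4)" "1 / qvar - (qvar ^ 2) ^ (2 * j)" "1 - qvar ^ (2 * j + 2)"]
      show ?thesis
        unfolding e e' by (simp only: mult.assoc)
    qed
    then show ?thesis
      unfolding quad_coef_def gterm_def prod.distrib[symmetric] prod_dividef[symmetric] by (intro prod.cong refl)
  qed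
  have pow: "1 - qvar * (qvar ^ 2) ^ (3 * k) = 1 - qvar ^ (6 * k + 1)" for k
    by (simp add: power_mult[symmetric])
  show ?thesis
    unfolding vertex_def quad_sum_def if_False
    by (simp only: pow coef[symmetric] mult.assoc times_divide_eq_right)
qed

text \<open>With \<open>p = qvar ^ 2\<close>, the value \<open>a = qvar / qvar ^ n\<close> is the
  inverse of \<open>p ^ M\<close> for \<open>M = (n - 1) div 2\<close>, so the sum vanishes
  identically; \<open>n > 1\<close> makes \<open>M\<close> positive.\<close>

lemma vertex_shifted_a:
  assumes n: "odd n" "n > 1"
  shows "vertex n True j i = 0"
proof -
  let ?q = qvar
  let ?a = "?q / ?q ^ n" and ?w = "if j then ?q ^ n / ?q else 1 / ?q"
  let ?u = "if i then ?q / ?q ^ n else ?q" and ?v = "if i then ?q * ?q ^ n else ?q"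
  let ?M = "(n - 1) div 2"
  obtain M where M: "n = 2 * M + 1" using n(1) by (elim oddE)
  \<comment> \<open>The exponents in the denominators are multiples of 4, whereas \<open>n\<close>
    is odd and \<open>2 * n\<close> is 2 modulo 4.\<close>
  have parity: "4 * k + 4 \<noteq> n" "4 * k + 4 \<noteq> 2 * n" for k
    using n(1) by presburger+
  have a: "?a * ?q ^ 2 * ?q * (?q ^ 2) ^ (2 * k) = ?q ^ (4 * k + 4) / ?q ^ n" for k
    unfolding power_mult[symmetric] by (simp add: power2_eq_square power_add power4_eq_xxxx)
  have uv: "?u * ?v = ?q ^ 2"
    by (simp add: power2_eq_square)
  have u_ne: "1 - ?a * ?q ^ 2 * ?u * (?q ^ 2) ^ (2 * k) \<noteq> 0" for k
  proof (cases i)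
    case True
    then have "?a * ?q ^ 2 * ?u * (?q ^ 2) ^ (2 * k) = ?q ^ (4 * k + 4) / ?q ^ (2 * n)"
      using a[of k] by (simp add: power_mult[of _ 2] power_mult[symmetric] mult_2 power_add)
    then show ?thesis using qvar_ratio_ne_one[OF parity(2)] by (simp only:) simp
  next
    case False
    then show ?thesis using a[of k] qvar_ratio_ne_one[OF parity(1)] by simp
  qed
  have v_ne: "1 - ?a * ?q ^ 2 * ?v * (?q ^ 2) ^ (2 * k) \<noteq> 0" for k
  proof (cases i)
    case True
    have "?a * ?q ^ 2 * (?q * ?q ^ n) * (?q ^ 2) ^ (2 * k) = (?a * ?q ^ 2 * ?q * (?q ^ 2) ^ (2 * k)) * ?q ^ n"
      by (simp only: mult_ac)
    also have "\<dots> = ?q ^ (4 * k + 4)"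
      unfolding a by simp
    finally show ?thesis using True by (simp only: if_True one_minus_qvar_power_nonzero) simp
  next
    case False
    then show ?thesis using a[of k] qvar_ratio_ne_one[OF parity(1)] by simp
  qed
  have p_ne: "1 - (?q ^ 2) ^ (2 * k + 2) \<noteq> 0" for k
    unfolding power_mult[symmetric] by (rule one_minus_qvar_power_nonzero) simp
  have "quad_num (?q ^ 2) ?a ?u ?v ?M ?w = 0"
  proof (rule quad_num_eq_zero[OF uv inj_qvar_sq_sq p_ne u_ne v_ne])
    show "?M > 0" using n M by simp
    show "?a * (?q ^ 2) ^ ?M = 1" using M by (simp add: power_mult[symmetric])
  qed
  moreover have "1 - ?a * (?q ^ 2) ^ (k + 1) * ?w \<noteq> 0" for k
  proof -
    have *: "?a * (?q ^ 2) ^ (k + 1) * ?w = (if j then ?q ^ (2 * k + 2) else ?q ^ (2 * k + 2) / ?q ^ n)"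
      unfolding power_mult[symmetric] by (simp add: power2_eq_square)
    have "2 * k + 2 \<noteq> n" using n(1) by presburger
    then show ?thesis
      unfolding * using qvar_ratio_ne_one[of "2 * k + 2" n] one_minus_qvar_power_nonzero[of "2 * k + 2"]
      by (cases j) simp_all
  qed
  ultimately show ?thesis
    unfolding vertex_def if_True by (subst quad_sum_eq_num) auto
qed

lemma prod_even_odd: "(\<Prod>i<2 * m. f i) = (\<Prod>i<m. f (2 * i) * f (2 * i + 1))"
  for f :: "nat \<Rightarrow> 'a::comm_monoid_mult"
  by (induction m) (simp_all add: mult_ac)

text \<open>Here \<open>w = qvar ^ n / qvar\<close> is the power \<open>p ^ (2 * m)\<close> of
  \<open>p = qvar ^ 2\<close>, so the evaluation at powers applies. Writing
  \<open>u = q / X i\<close> and \<open>v = q * X i\<close> treats both values of \<open>i\<close>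
  at once.\<close>

lemma vertex_shifted_w:
  assumes n: "n = 4 * m + 1"
  defines "X \<equiv> \<lambda>i. if i then qvar ^ n else 1"
  shows "vertex n False True i = (1 - qvar) * (\<Prod>j<m. (1 - qvar ^ (4 * j + 3)) * (1 - qvar ^ (4 * j + 5))
    / ((1 - qvar ^ (4 * j + 4) / X i) * (1 - qvar ^ (4 * j + 4) * X i)))"
proof -
  let ?q = qvar
  let ?u = "?q / X i" and ?v = "?q * X i"
  let ?M = "(n - 1) div 2"
  have X: "X i \<noteq> 0" by (simp add: X_def)
  have uv: "?u * ?v = ?q ^ 2"
    using X by (simp add: power2_eq_square)
  have u: "?q * ?q ^ 2 * ?u * (?q ^ 2) ^ (2 * k) = ?q ^ (4 * k + 4) / X i"
    and v: "?q * ?q ^ 2 * ?v * (?q ^ 2) ^ (2 * k) = ?q ^ (4 * k + 4) * X i" for k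
    unfolding power_mult[symmetric] by (simp_all add: power_add power2_eq_square power4_eq_xxxx)
  have p_ne: "1 - (?q ^ 2) ^ (2 * k + 2) \<noteq> 0" for k
    unfolding power_mult[symmetric] by (rule one_minus_qvar_power_nonzero) simp
  have u_ne: "1 - ?q * ?q ^ 2 * ?u * (?q ^ 2) ^ (2 * k) \<noteq> 0" for k
  proof -
    have "4 * k + 4 \<noteq> n" "4 * k + 4 \<noteq> 0" using n by presburger+
    then show ?thesis
      unfolding u unfolding X_def
      using qvar_ratio_ne_one[of "4 * k + 4" n] one_minus_qvar_power_nonzero[of "4 * k + 4"] by simp
  qed
  have v_ne: "1 - ?q * ?q ^ 2 * ?v * (?q ^ 2) ^ (2 * k) \<noteq> 0" for k
    unfolding v unfolding X_def using one_minus_qvar_power_nonzero[of "4 * k + 4"] one_minus_qvar_power_nonzero[of "4 * k + 4 + n"]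
    by (simp add: power_add)
  have a1: "?q * (?q ^ 2) ^ (k + 1) = ?q ^ (2 * k + 3)" for k
    unfolding power_mult[symmetric] by (simp add: power_add power2_eq_square power3_eq_cube)
  have a3: "?q * (?q ^ 2) ^ (2 * k + 1) = ?q ^ (4 * k + 3)"
    and a5: "?q * (?q ^ 2) ^ (2 * k + 2) = ?q ^ (4 * k + 5)" for k
    using a1[of "2 * k"] a1[of "2 * k + 1"] by simp_all
  have a_ne: "1 - ?q * (?q ^ 2) ^ (k + 1) \<noteq> 0" for k
    unfolding a1 by (rule one_minus_qvar_power_nonzero) simp
  have w: "?q ^ n / ?q = (?q ^ 2) ^ (2 * m)"
    using n by (simp add: power_mult[symmetric])
  have "vertex n False True i = quad_sum (?q ^ 2) ?q ?u ?v ?M ((?q ^ 2) ^ (2 * m))"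
    unfolding vertex_def w[symmetric] X_def by simp
  also have "\<dots> = (1 - ?q) * (\<Prod>j<m. (1 - ?q * (?q ^ 2) ^ (2 * j + 1)) * (1 - ?q * (?q ^ 2) ^ (2 * j + 2))
     / ((1 - ?q * ?q ^ 2 * ?u * (?q ^ 2) ^ (2 * j)) * (1 - ?q * ?q ^ 2 * ?v * (?q ^ 2) ^ (2 * j))))"
    using n by (intro quad_sum_at_power[OF uv p_ne u_ne v_ne a_ne]) simp
  also have "\<dots> = (1 - ?q) * (\<Prod>j<m. (1 - ?q ^ (4 * j + 3)) * (1 - ?q ^ (4 * j + 5))
    / ((1 - ?q ^ (4 * j + 4) / X i) * (1 - ?q ^ (4 * j + 4) * X i)))"
    unfolding u v a3 a5 ..
  finally show ?thesis .
qed

text \<open>Here \<open>u = qvar / qvar ^ n\<close> is the inverse of \<open>p ^ (2 * m)\<close> for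
  \<open>p = qvar ^ 2\<close>, so the sum is proportional to \<open>H\<close>; comparing
  \<open>w = 1 / q\<close> with \<open>w = 1\<close> gives the value.\<close>

lemma vertex_shifted_x:
  assumes n: "n = 4 * m + 1"
  shows "vertex n False False True
    = (1 - qvar ^ n) / qvar ^ m * (\<Prod>i<m. (1 - qvar ^ (4 * i + 2)) / (1 - qvar ^ (4 * i + 4)))"
proof -
  let ?q = qvar
  let ?u = "?q / ?q ^ n" and ?v = "?q * ?q ^ n"
  let ?N = "quad_num (?q ^ 2) ?q ?u ?v (2 * m)"
  have idx: "2 * (2 * i) + 3 = 4 * i + 3" "2 * (2 * i + 1) + 3 = 4 * i + 5" "2 * (2 * i) + 2 = 4 * i + 2"
    "2 * (2 * i + 1) + 2 = 4 * i + 4" "4 * Suc i + 1 = 4 * i + 5" for i :: nat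
    by simp_all
  define H where "H = (\<lambda>w. \<Prod>i<m. (1 - ?q * w / (?q ^ 2) ^ (2 * i + 1)) * (1 - ?q * w * (?q ^ 2) ^ (2 * i + 1)))"
  \<comment> \<open>The four products collect the exponents by residue class modulo 4, and
    \<open>L\<close> collects the signs and powers from turning \<open>1 - 1 / q ^ k\<close> into a
    multiple of \<open>1 - q ^ k\<close>.\<close>
  define PA where "PA = (\<Prod>i<m. 1 - ?q ^ (4 * i + 1))"
  define PB where "PB = (\<Prod>i<m. 1 - ?q ^ (4 * i + 2))"
  define PC where "PC = (\<Prod>i<m. 1 - ?q ^ (4 * i + 3))"
  define PD where "PD = (\<Prod>i<m. 1 - ?q ^ (4 * i + 4))"
  define L where "L = (\<Prod>i<m. - 1 / ?q ^ (4 * i + 1))"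
  have ne: "PA \<noteq> 0" "PB \<noteq> 0" "PC \<noteq> 0" "PD \<noteq> 0" "L \<noteq> 0"
    unfolding PA_def PB_def PC_def PD_def L_def by (simp_all del: power_Suc add: prod_zero_iff del: right_minus_eq)
  have u: "?q * ?q ^ 2 * ?u * (?q ^ 2) ^ (2 * k) = ?q ^ (4 * k + 4) / ?q ^ n"
    and v: "?q * ?q ^ 2 * ?v * (?q ^ 2) ^ (2 * k) = ?q ^ (4 * k + 4 + n)" for k
    unfolding power_mult[symmetric] by (simp_all add: power_add power2_eq_square power4_eq_xxxx)
  have u_ne: "1 - ?q * ?q ^ 2 * ?u * (?q ^ 2) ^ (2 * k) \<noteq> 0" for k
  proof -
    have "4 * k + 4 \<noteq> n" using n by presburger
    then show ?thesis unfolding u by (rule qvar_ratio_ne_one)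
  qed
  have v_ne: "1 - ?q * ?q ^ 2 * ?v * (?q ^ 2) ^ (2 * k) \<noteq> 0" for k
    unfolding v by (rule one_minus_qvar_power_nonzero) simp
  have p_ne: "1 - (?q ^ 2) ^ (2 * k + 2) \<noteq> 0" for k
    unfolding power_mult[symmetric] by (rule one_minus_qvar_power_nonzero) simp
  have uv: "?u * ?v = ?q ^ 2"
    by (simp add: power2_eq_square)
  have fac: "?N (1 / ?q) * H 1 = ?N 1 * H (1 / ?q)"
    unfolding H_def
    by (rule quad_num_factor[OF uv inj_qvar_sq_sq p_ne u_ne v_ne])
      (simp_all add: n power_mult[symmetric])
  have inv: "1 - 1 / ?q ^ k = - 1 / ?q ^ k * (1 - ?q ^ k)" for k
    by (simp add: field_simps)
  have H1: "H 1 = L * PA * PC"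
  proof -
    have "?q * 1 / (?q ^ 2) ^ (2 * i + 1) = 1 / ?q ^ (4 * i + 1)" "?q * 1 * (?q ^ 2) ^ (2 * i + 1) = ?q ^ (4 * i + 3)" for i
      unfolding power_mult[symmetric] by (simp_all add: power_add power2_eq_square power3_eq_cube)
    then show ?thesis
      unfolding H_def L_def PA_def PC_def prod.distrib[symmetric] by (simp only: inv)
  qed
  have Hq: "H (1 / ?q) = L / ?q ^ m * PB * PB"
  proof -
    have "?q * (1 / ?q) / (?q ^ 2) ^ (2 * i + 1) = 1 / ?q ^ (4 * i + 2)" "?q * (1 / ?q) * (?q ^ 2) ^ (2 * i + 1) = ?q ^ (4 * i + 2)" for i
      unfolding power_mult[symmetric] by (simp_all add: power_add power2_eq_square)
    moreover have "L / ?q ^ m = (\<Prod>i<m. - 1 / ?q ^ (4 * i + 2))"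
    proof -
      have "L / ?q ^ m = L * (\<Prod>i<m. 1 / ?q)"
        by (simp add: power_one_over)
      also have "\<dots> = (\<Prod>i<m. - 1 / ?q ^ (4 * i + 2))"
        unfolding L_def prod.distrib[symmetric] by (simp add: mult_ac)
      finally show ?thesis .
    qed
    ultimately show ?thesis
      unfolding H_def PB_def prod.distrib[symmetric] by (simp only: inv prod.distrib)
  qed
  \<comment> \<open>The exponents are the odd numbers from 1 to \<open>4 * m + 1\<close>; the last
    of them is \<open>n\<close>, which splits off the factor \<open>1 - q ^ n\<close>.\<close>
  have N1: "?N 1 = PC * PA * (1 - ?q ^ n)"
  proof -
    have "?N 1 = (1 - ?q) * (\<Prod>i<2*m. 1 - ?q ^ (2 * i + 3))"
      unfolding quad_num_at_one
      unfolding power_mult[symmetric] by (simp add: power_add power2_eq_square power3_eq_cube mult_ac)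
    also have "\<dots> = (1 - ?q) * (PC * (\<Prod>i<m. 1 - ?q ^ (4 * i + 5)))"
      unfolding prod_even_odd PC_def prod.distrib[symmetric] idx ..
    also have "(1 - ?q) * (PC * (\<Prod>i<m. 1 - ?q ^ (4 * i + 5))) = PC * ((1 - ?q) * (\<Prod>i<m. 1 - ?q ^ (4 * i + 5)))"
      by (simp only: mult_ac)
    also have "(1 - ?q) * (\<Prod>i<m. 1 - ?q ^ (4 * i + 5)) = PA * (1 - ?q ^ n)"
    proof -
      have "(\<Prod>i<Suc m. 1 - ?q ^ (4 * i + 1)) = PA * (1 - ?q ^ n)"
        by (simp add: PA_def n)
      moreover have "(\<Prod>i<Suc m. 1 - ?q ^ (4 * i + 1)) = (1 - ?q) * (\<Prod>i<m. 1 - ?q ^ (4 * i + 5))"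
        unfolding prod.lessThan_Suc_shift idx by simp
      ultimately show ?thesis by simp
    qed
    finally show ?thesis by (simp only: mult.assoc)
  qed
  have e: "1 - ?q * (?q ^ 2) ^ (i + 1) * (1 / ?q) = 1 - ?q ^ (2 * i + 2)" for i
    unfolding power_mult[symmetric] by (simp add: power2_eq_square)
  have "vertex n False False True = ?N (1 / ?q) / (\<Prod>i<2*m. 1 - ?q * (?q ^ 2) ^ (i + 1) * (1 / ?q))"
  proof -
    have "vertex n False False True = quad_sum (?q ^ 2) ?q ?u ?v (2 * m) (1 / ?q)"
      unfolding vertex_def using n by simp
    also have "\<dots> = ?N (1 / ?q) / (\<Prod>i<2*m. 1 - ?q * (?q ^ 2) ^ (i + 1) * (1 / ?q))"
      by (rule quad_sum_eq_num, unfold e, rule one_minus_qvar_power_nonzero) simp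
    finally show ?thesis .
  qed
  also have "(\<Prod>i<2*m. 1 - ?q * (?q ^ 2) ^ (i + 1) * (1 / ?q)) = PB * PD"
    unfolding e prod_even_odd PB_def PD_def prod.distrib[symmetric] idx ..
  also have "?N (1 / ?q) = (1 - ?q ^ n) / ?q ^ m * PB * PB"
  proof -
    have "?N (1 / ?q) * (L * PA * PC) = ((1 - ?q ^ n) / ?q ^ m * PB * PB) * (L * PA * PC)"
      using fac unfolding H1 Hq N1 by (simp add: mult_ac)
    moreover have "L * PA * PC \<noteq> 0" using ne by simp
    ultimately show ?thesis by (simp only: mult_cancel_right) simp
  qed
  finally show ?thesis
    using ne by (simp add: PB_def PD_def prod_dividef)
qed

section \<open>Primitive roots of unity and the behaviour of the cube there\<close>

text \<open>For \<open>d > 0\<close> this says that the multiplicative order is exactly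
  \<open>d\<close>, phrased so that nonvanishing of \<open>1 - z ^ j\<close> becomes a divisibility
  question.\<close>

definition primitive_root :: "complex \<Rightarrow> nat \<Rightarrow> bool" where
  "primitive_root z d \<longleftrightarrow> (\<forall>j. z ^ j = 1 \<longleftrightarrow> d dvd j)"

lemma primitive_root_power [simp]: "primitive_root z d \<Longrightarrow> z ^ d = 1"
  by (simp add: primitive_root_def)

lemma primitive_root_nonzero: "primitive_root z d \<Longrightarrow> d > 0 \<Longrightarrow> z \<noteq> 0"
  using primitive_root_power[of z d] by (auto simp: power_0_left simp del: primitive_root_power)

lemma primitive_root_ne:
  assumes "primitive_root z d" "coprime s d" "\<not> d dvd k"
  shows "1 - z ^ (s * k) \<noteq> 0"
  using assms by (auto simp: primitive_root_def coprime_commute coprime_dvd_mult_right_iff)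

lemma has_value_one_minus_power: "has_value z (1 - qvar ^ j) (1 - z ^ j)"
  by (intro has_value_intros)

lemma odd_imp_coprime_powers_of_two:
  fixes d :: nat
  assumes "odd d"
  shows "coprime 2 d" "coprime 4 d"
proof -
  show "coprime 2 d" using assms by simp
  then have "coprime (2 * 2) d" by (simp only: coprime_mult_left_iff)
  then show "coprime 4 d" by simp
qed

lemma half_less_not_dvd:
  fixes n :: nat
  assumes "k < (n - 1) div 2"
  shows "\<not> n dvd (k + 1)"
  using assms by (auto dest!: dvd_imp_le)

text \<open>The parameters have the weights of the cube, and the summands are built from them by
  operations that preserve it. The only inversions are of denominators that are nonzero at
  \<open>z\<close>.\<close>

lemma cube_vertex:
  assumes prim: "primitive_root z n" and n: "odd n" "n > 1"
  shows "cube z (vertex n)"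
proof -
  let ?q = qvar
  let ?p = "qvar ^ 2"
  define aa where "aa = (\<lambda>l. if l then ?q / ?q ^ n else ?q)"
  define ww where "ww = (\<lambda>j. if j then ?q ^ n / ?q else 1 / ?q)"
  define uu where "uu = (\<lambda>i. if i then ?q / ?q ^ n else ?q)"
  define vv where "vv = (\<lambda>i. if i then ?q * ?q ^ n else ?q)"
  have z: "z \<noteq> 0" using primitive_root_nonzero[OF prim] n by simp
  have q: "has_value z ?q z" by (rule has_value_qvar)
  have r: "has_value z (?q ^ n) 1"
    using has_value_power[OF q, of n] prim by simp
  have v_aa: "has_value z (aa l) z" for l
    using has_value_divide[OF q r] q by (simp add: aa_def)
  have v_ww: "has_value z (ww j) (1 / z)" for j
    using has_value_divide[OF r q] has_value_divide[OF has_value_1 q] z by (simp add: ww_def)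
  have v_uu: "has_value z (uu i) z" for i
    using has_value_divide[OF q r] q by (simp add: uu_def)
  have v_vv: "has_value z (vv i) z" for i
    using has_value_mult[OF q r] q by (simp add: vv_def)
  have r1: "ord_ge z 1 (1 - ?q ^ n)"
    using has_value_0_imp_ord_ge_1[of z "1 - ?q ^ n"] has_value_diff[OF has_value_1 r] by simp
  have c_aa: "cube z (\<lambda>l j i. aa l)"
  proof -
    have "?q / ?q ^ n - ?q = (1 - ?q ^ n) * (?q / ?q ^ n)"
      by (simp add: field_simps)
    then have "ord_ge z 1 (?q / ?q ^ n - ?q)"
      using ord_ge_mult_0[OF r1 has_value_imp_ord_ge_0[OF has_value_divide[OF q r]]] by simp
    then show ?thesis
      using has_value_imp_ord_ge_0[OF q] by (simp add: cube_def edge_def aa_def)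
  qed
  have c_ww: "cube z (\<lambda>l j i. ww j)"
  proof -
    have "?q ^ n / ?q - 1 / ?q = (1 - ?q ^ n) * (- 1 / ?q)"
      by (simp add: field_simps)
    moreover have "has_value z (- 1 / ?q) (- 1 / z)"
      by (intro has_value_divide has_value_minus has_value_1 q z)
    ultimately have "ord_ge z 1 (?q ^ n / ?q - 1 / ?q)"
      using ord_ge_mult_0[OF r1 has_value_imp_ord_ge_0] by metis
    then show ?thesis
      using has_value_imp_ord_ge_0[OF v_ww[of False]] by (simp add: cube_def edge_def ww_def)
  qed
  have c_uv: "cube z (\<lambda>l j i. uu i + vv i)"
  proof -
    \<comment> \<open>Only the sum \<open>u + v\<close> changes to second order; \<open>u\<close>
      and \<open>v\<close> separately change to first order.\<close>
    have "?q / ?q ^ n + ?q * ?q ^ n - (?q + ?q) = (1 - ?q ^ n) * (1 - ?q ^ n) * (?q / ?q ^ n)"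
      by (simp add: field_simps)
    then have "ord_ge z 2 (?q / ?q ^ n + ?q * ?q ^ n - (?q + ?q))"
      using ord_ge_mult_0[OF ord_ge_mult[OF r1 r1] has_value_imp_ord_ge_0[OF has_value_divide[OF q r]]]
      by (simp add: numeral_2_eq_2)
    then show ?thesis
      using has_value_imp_ord_ge_0[OF has_value_add[OF q q]] by (simp add: cube_def edge_def uu_def vv_def numeral_2_eq_2[symmetric])
  qed
  have uv: "uu i * vv i = ?p" for i
    by (simp add: uu_def vv_def power2_eq_square)
  have c_pq: "cube z (\<lambda>l j i. ?q ^ k)" for k
    by (rule cube_const, rule has_value_imp_ord_ge_0, rule has_value_power, rule q)
  have c_pp: "cube z (\<lambda>l j i. ?p ^ k)" for k
    unfolding power_mult[symmetric] by (rule c_pq)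
  have c_1: "cube z (\<lambda>l j i. 1)"
    using c_pq[of 0] by simp
  \<comment> \<open>As \<open>u * v\<close> is constant, the two factors with \<open>u\<close> and
    \<open>v\<close> are expanded together; singly they would not have weight 2 in direction
    \<open>i\<close>.\<close>
  have c_n: "cube z (\<lambda>l j i. (1 - uu i * ?p ^ k) * (1 - vv i * ?p ^ k))" for k
  proof -
    have "(1 - uu i * ?p ^ k) * (1 - vv i * ?p ^ k) = 1 - (uu i + vv i) * ?p ^ k + ?p * (?p ^ k * ?p ^ k)" for i
      unfolding uv[of i, symmetric] by (simp add: algebra_simps)
    then show ?thesis
      by (simp only:) (intro cube_add cube_diff cube_mult c_1 c_uv c_pp c_pq)
  qed
  have c_d: "cube z (\<lambda>l j i. (1 - aa l * ?p * uu i * ?p ^ k) * (1 - aa l * ?p * vv i * ?p ^ k))" for k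
  proof -
    have "(1 - aa l * ?p * uu i * ?p ^ k) * (1 - aa l * ?p * vv i * ?p ^ k)
        = 1 - aa l * ?p * (uu i + vv i) * ?p ^ k + aa l * ?p * (aa l * ?p) * (uu i * vv i) * (?p ^ k * ?p ^ k)" for l i
      by (simp add: algebra_simps)
    then show ?thesis
      unfolding uv by (simp only:) (intro cube_add cube_diff cube_mult c_1 c_uv c_aa c_pp c_pq)
  qed
  \<comment> \<open>Every denominator specialises to such a factor at \<open>z\<close>:
    \<open>k + 1\<close> is positive and below \<open>n\<close>, and 2 and 4 are coprime to the odd
    \<open>n\<close>.\<close>
  have ne4: "1 - z ^ (4 * (k + 1)) \<noteq> 0" and ne2: "1 - z ^ (2 * (k + 1)) \<noteq> 0" if "k < (n - 1) div 2" for k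
    using primitive_root_ne[OF prim _ half_less_not_dvd[OF that]] odd_imp_coprime_powers_of_two[OF n(1)] by blast+
  have d1: "\<exists>c. has_value z ((1 - ?p ^ (2 * k + 2)) * ((1 - aa l * ?p * uu i * ?p ^ (2 * k)) * (1 - aa l * ?p * vv i * ?p ^ (2 * k)))) c \<and> c \<noteq> 0"
    if "k < (n - 1) div 2" for k l i
  proof (intro exI conjI)
    show "has_value z ((1 - ?p ^ (2 * k + 2)) * ((1 - aa l * ?p * uu i * ?p ^ (2 * k)) * (1 - aa l * ?p * vv i * ?p ^ (2 * k))))
       ((1 - (z ^ 2) ^ (2 * k + 2)) * ((1 - z * z ^ 2 * z * (z ^ 2) ^ (2 * k)) * (1 - z * z ^ 2 * z * (z ^ 2) ^ (2 * k))))"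
      by (intro has_value_mult has_value_diff has_value_1 has_value_power q v_aa v_uu v_vv)
    have "(z ^ 2) ^ (2 * k + 2) = z ^ (4 * (k + 1))" "z * z ^ 2 * z * (z ^ 2) ^ (2 * k) = z ^ (4 * (k + 1))"
      unfolding power_mult[symmetric] by (simp_all add: power_add power2_eq_square power4_eq_xxxx)
    then show "(1 - (z ^ 2) ^ (2 * k + 2)) * ((1 - z * z ^ 2 * z * (z ^ 2) ^ (2 * k)) * (1 - z * z ^ 2 * z * (z ^ 2) ^ (2 * k))) \<noteq> 0"
      using ne4[OF that] by simp
  qed
  have d2: "\<exists>c. has_value z (\<Prod>i<k. 1 - aa l * ?p ^ (i + 1) * ww j) c \<and> c \<noteq> 0"
    if "k \<le> (n - 1) div 2" for k l j
  proof (intro exI conjI)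
    show "has_value z (\<Prod>i<k. 1 - aa l * ?p ^ (i + 1) * ww j) (\<Prod>i<k. 1 - z * (z ^ 2) ^ (i + 1) * (1 / z))"
      by (intro has_value_prod has_value_diff has_value_mult has_value_1 has_value_power q v_aa v_ww)
    have "z * (z ^ 2) ^ (i + 1) * (1 / z) = z ^ (2 * (i + 1))" for i
      using z unfolding power_mult[symmetric] by simp
    then show "(\<Prod>i<k. 1 - z * (z ^ 2) ^ (i + 1) * (1 / z)) \<noteq> 0"
      using ne2 that by (subst prod_zero_iff) (auto simp del: power_Suc)
  qed
  have "cube z (\<lambda>l j i. \<Sum>k\<le>(n - 1) div 2. (1 - aa l * ?p ^ (3 * k)) * quad_coef ?p (aa l) (uu i) (vv i) k
     * (\<Prod>h<k. ww j - ?p ^ (2 * h)) / (\<Prod>h<k. 1 - aa l * ?p ^ (h + 1) * ww j))"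
  proof (rule cube_sum)
    fix k assume "k \<in> {..(n - 1) div 2}"
    then have k: "k \<le> (n - 1) div 2" by simp
    have c: "cube z (\<lambda>l j i. quad_coef ?p (aa l) (uu i) (vv i) k)"
      unfolding quad_coef_def
    proof (rule cube_prod)
      fix h assume "h \<in> {..<k}"
      then have h: "h < (n - 1) div 2" using k by simp
      show "cube z (\<lambda>l j i. (1 - aa l * ?p ^ h) * ((1 - uu i * ?p ^ h) * (1 - vv i * ?p ^ h)) * (aa l * ?p ^ (h + 1))
         / ((1 - ?p ^ (2 * h + 2)) * ((1 - aa l * ?p * uu i * ?p ^ (2 * h)) * (1 - aa l * ?p * vv i * ?p ^ (2 * h)))))"
        by (rule cube_divide[OF _ _ d1[OF h]])
          (intro cube_mult cube_diff c_1 c_aa c_pp c_n c_d)+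
    qed
    show "cube z (\<lambda>l j i. (1 - aa l * ?p ^ (3 * k)) * quad_coef ?p (aa l) (uu i) (vv i) k
     * (\<Prod>h<k. ww j - ?p ^ (2 * h)) / (\<Prod>h<k. 1 - aa l * ?p ^ (h + 1) * ww j))"
      by (rule cube_divide[OF _ _ d2[OF k]])
        (intro cube_mult cube_diff cube_prod c_1 c_aa c_ww c_pp c)+
  qed
  also have "(\<lambda>l j i. \<Sum>k\<le>(n - 1) div 2. (1 - aa l * ?p ^ (3 * k)) * quad_coef ?p (aa l) (uu i) (vv i) k
     * (\<Prod>h<k. ww j - ?p ^ (2 * h)) / (\<Prod>h<k. 1 - aa l * ?p ^ (h + 1) * ww j)) = vertex n"
    unfolding vertex_def quad_sum_def aa_def uu_def vv_def ww_def ..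
  finally show ?thesis .
qed

text \<open>The neighbour of the origin in direction \<open>l\<close> is identically zero and that
  edge has weight 1, so the origin itself vanishes at \<open>z\<close>.\<close>

lemma has_value_sum_gterm:
  assumes "primitive_root z n" "odd n" "n > 1"
  shows "has_value z (\<Sum>k\<le>(n - 1) div 2. (1 - qvar ^ (6 * k + 1)) * gterm k) 0"
  unfolding vertex_origin[symmetric]
  using cube_imp_first_difference[OF cube_vertex[OF assms]] vertex_shifted_a[OF assms(2,3)]
    ord_ge_minus[of z 1 "- vertex n False False False"]
  by (intro ord_ge_1_imp_has_value_0) simp

text \<open>The mixed third difference, after the four zero vertices with shifted \<open>a\<close>
  have dropped out.\<close>

lemma ord_ge_4_vertex:
  assumes "primitive_root z n" "odd n" "n > 1"
  shows "ord_ge z 4 (vertex n False False False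
    - (vertex n False False True + vertex n False True False - vertex n False True True))"
  using ord_ge_minus[OF cube_imp_third_difference[OF cube_vertex[OF assms]]] vertex_shifted_a[OF assms(2,3)]
  by (simp add: algebra_simps)

section \<open>Orders of shifted factorials and vanishing by blocks\<close>

lemma prod_lessThan_add: "(\<Prod>i<m + n. f i) = (\<Prod>i<m. f i) * (\<Prod>i<n. f (m + i))"
  for f :: "nat \<Rightarrow> 'a::comm_monoid_mult"
  by (induction n) (simp_all add: mult.assoc)

lemma sum_lessThan_add: "(\<Sum>i<m + n. f i) = (\<Sum>i<m. f i) + (\<Sum>i<n. f (m + i))"
  for f :: "nat \<Rightarrow> 'a::comm_monoid_add"
  by (induction n) (simp_all add: add.assoc)

lemma sum_lessThan_blocks: "(\<Sum>k<L * d. f k) = (\<Sum>l<L. \<Sum>r<d. f (l * d + r))"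
  for f :: "nat \<Rightarrow> 'a::comm_monoid_add"
  by (induction L) (simp_all add: sum_lessThan_add add.commute[of d])

text \<open>The zero at \<open>z\<close> is simple because the derivative
  \<open>- j * z ^ (j - 1)\<close> does not vanish there; by the product rule it is the value of the
  cofactor.\<close>

lemma one_minus_power_simple_zero:
  assumes prim: "primitive_root z d" and j: "d dvd j" "j > 0"
  shows "\<exists>U c. 1 - qvar ^ j = to_fract [:- z, 1:] * U \<and> has_value z U c \<and> c \<noteq> 0"
proof -
  let ?P = "1 - [:0, 1:] ^ j :: complex poly"
  have zj: "z ^ j = 1" using prim j(1) by (simp add: primitive_root_def)
  have "poly ?P z = 0" using zj by simp
  then have "[:- z, 1:] dvd ?P" by (simp only: poly_eq_0_iff_dvd)
  then obtain A where A: "?P = [:- z, 1:] * A" by (elim dvdE)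
  have "poly (pderiv ?P) z = - of_nat j * z ^ (j - 1)"
    by (simp add: pderiv_diff pderiv_power pderiv_pCons)
  moreover have "poly (pderiv ?P) z = poly A z"
    unfolding A pderiv_mult by (simp add: pderiv_pCons)
  ultimately have "poly A z = - of_nat j * z ^ (j - 1)" by simp
  moreover have "z \<noteq> 0" using zj j(2) by (auto simp: power_0_left)
  ultimately have "poly A z \<noteq> 0" using j(2) by simp
  moreover have "1 - qvar ^ j = to_fract [:- z, 1:] * to_fract A"
    unfolding qvar_def to_fract_power[symmetric] to_fract_1[symmetric] to_fract_diff[symmetric]
      to_fract_mult[symmetric] A ..
  ultimately show ?thesis using has_value_to_fract by blast
qed

lemma ord_ge_1_one_minus_power:
  assumes "primitive_root z d" "d dvd j"
  shows "ord_ge z 1 (1 - qvar ^ j)"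
proof -
  have "z ^ j = 1" using assms by (simp add: primitive_root_def)
  then show ?thesis
    using has_value_one_minus_power[of z j] by (intro has_value_0_imp_ord_ge_1) simp
qed

lemma ord_ge_0_one_minus_power_ratio:
  assumes prim: "primitive_root z d" and "d dvd n" "j > 0"
  shows "ord_ge z 0 ((1 - qvar ^ n) / (1 - qvar ^ j))"
proof (cases "d dvd j")
  case True
  obtain U c where U: "1 - qvar ^ j = to_fract [:- z, 1:] * U" "has_value z U c" "c \<noteq> 0"
    using one_minus_power_simple_zero[OF prim True \<open>j > 0\<close>] by blast
  have "ord_ge z 1 (1 - qvar ^ n)"
    using ord_ge_1_one_minus_power[OF prim \<open>d dvd n\<close>] .
  then obtain g b where g: "has_value z g b" "1 - qvar ^ n = to_fract [:- z, 1:] * g"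
    unfolding ord_ge_def by auto
  have "to_fract [:- z, 1:] \<noteq> 0" by simp
  then have "(1 - qvar ^ n) / (1 - qvar ^ j) = g / U"
    unfolding g(2) U(1) by simp
  then show ?thesis
    using has_value_divide[OF g(1) U(2,3)] has_value_imp_ord_ge_0 by simp
next
  case False
  then have "1 - z ^ j \<noteq> 0" using prim by (simp add: primitive_root_def)
  then show ?thesis
    using has_value_divide[OF has_value_one_minus_power has_value_one_minus_power] has_value_imp_ord_ge_0 by blast
qed

text \<open>As \<open>s\<close> is invertible modulo \<open>d\<close>, any \<open>d\<close>
  consecutive indices contain one with \<open>d dvd s * i + e\<close>. Each full block thus
  contributes a zero.\<close>

lemma ord_ge_prod_one_minus_power:
  assumes prim: "primitive_root z d" and s: "coprime s d" and d: "d > 0"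
  shows "ord_ge z (k div d) (\<Prod>i<k. 1 - qvar ^ (s * i + e))"
proof -
  let ?f = "\<lambda>i. 1 - qvar ^ (s * i + e)"
  have block: "ord_ge z 1 (\<Prod>i<d. ?f (b + i))" for b
  proof -
    obtain i where i: "i < d" "d dvd s * (b + i) + e"
    proof -
      obtain x where x: "[s * x = 1] (mod d)"
        using cong_solve_coprime_nat[OF s] by auto
      \<comment> \<open>The offset solves a linear congruence through the inverse \<open>x\<close>
        of \<open>s\<close>; the natural number \<open>d * t - t\<close> stands for
        \<open>- t\<close> modulo \<open>d\<close>, where \<open>t = s * b + e\<close>.\<close>
      have "[s * (b + (x * (d * (s * b + e) - (s * b + e)) mod d)) + e = 0] (mod d)"
      proof -
        let ?t = "s * b + e"
        let ?y = "d * ?t - ?t"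
        have le: "?t \<le> d * ?t" using d by simp
        have "[s * (x * ?y mod d) = s * (x * ?y)] (mod d)"
          by (intro cong_mult cong_refl) (simp add: cong_def)
        also have "[s * (x * ?y) = 1 * ?y] (mod d)"
          unfolding mult.assoc[symmetric] by (intro cong_mult x cong_refl)
        finally have "[?t + s * (x * ?y mod d) = ?t + ?y] (mod d)"
          by (intro cong_add) (simp_all add: cong_def)
        moreover have "?t + ?y = d * ?t" using le by simp
        ultimately have "[?t + s * (x * ?y mod d) = 0] (mod d)"
          by (simp add: cong_def)
        then show ?thesis by (simp add: algebra_simps)
      qed
      then show ?thesis
        using d by (intro that[of "x * (d * (s * b + e) - (s * b + e)) mod d"]) (simp_all add: cong_0_iff)
    qed
    have "(\<Prod>i<d. ?f (b + i)) = ?f (b + i) * (\<Prod>i\<in>{..<d} - {i}. ?f (b + i))"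
      using i(1) by (intro prod.remove) auto
    moreover have "ord_ge z 1 (?f (b + i))"
      using ord_ge_1_one_minus_power[OF prim i(2)] .
    moreover have "ord_ge z 0 (\<Prod>i\<in>{..<d} - {i}. ?f (b + i))"
      by (rule has_value_imp_ord_ge_0) (rule has_value_prod, rule has_value_one_minus_power)
    ultimately show ?thesis using ord_ge_mult_0 by simp
  qed
  have full: "ord_ge z l (\<Prod>i<l * d. ?f i)" for l
  proof (induction l)
    case 0
    then show ?case by (simp add: has_value_imp_ord_ge_0[OF has_value_1])
  next
    case (Suc l)
    then show ?case
      using ord_ge_mult[OF Suc block[of "l * d"]] prod_lessThan_add[of ?f "l * d" d] by (simp add: add.commute)
  qed
  have "(\<Prod>i<k. ?f i) = (\<Prod>i<k div d * d. ?f i) * (\<Prod>i<k mod d. ?f (k div d * d + i))"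
    using prod_lessThan_add[of ?f "k div d * d" "k mod d"] by simp
  moreover have "ord_ge z 0 (\<Prod>i<k mod d. ?f (k div d * d + i))"
    by (rule has_value_imp_ord_ge_0) (rule has_value_prod, rule has_value_one_minus_power)
  ultimately show ?thesis
    using ord_ge_mult_0[OF full] by simp
qed

text \<open>A factor vanishes at \<open>z\<close> exactly when \<open>d\<close> divides
  \<open>i + 1\<close>, and then simply, so the order is exactly \<open>k div d\<close>.
  Denominators need this exact count.\<close>

lemma prod_one_minus_power_exact:
  assumes prim: "primitive_root z d" and s: "coprime s d" "s > 0" and d: "d > 0"
  shows "\<exists>U c. (\<Prod>i<k. 1 - qvar ^ (s * (i + 1))) = to_fract [:- z, 1:] ^ (k div d) * U \<and> has_value z U c \<and> c \<noteq> 0"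
proof (induction k)
  case 0
  show ?case by (intro exI[of _ 1]) auto
next
  case (Suc k)
  then obtain U c where U: "(\<Prod>i<k. 1 - qvar ^ (s * (i + 1))) = to_fract [:- z, 1:] ^ (k div d) * U"
    "has_value z U c" "c \<noteq> 0" by blast
  show ?case
  proof (cases "d dvd Suc k")
    case True
    then have "d dvd s * (k + 1)" by (intro dvd_mult) simp
    then obtain V b where V: "1 - qvar ^ (s * (k + 1)) = to_fract [:- z, 1:] * V" "has_value z V b" "b \<noteq> 0"
      using one_minus_power_simple_zero[OF prim, of "s * (k + 1)"] s by auto
    have "Suc k div d = Suc (k div d)"
      using True d by (simp add: div_Suc dvd_eq_mod_eq_0)
    then have "(\<Prod>i<Suc k. 1 - qvar ^ (s * (i + 1))) = to_fract [:- z, 1:] ^ (Suc k div d) * (U * V)"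
      unfolding prod.lessThan_Suc U(1) V(1) by (simp only: power_Suc mult_ac)
    moreover have "has_value z (U * V) (c * b)" "c * b \<noteq> 0"
      using U V by (auto intro: has_value_mult)
    ultimately show ?thesis by blast
  next
    case False
    then have "1 - z ^ (s * (k + 1)) \<noteq> 0"
      using primitive_root_ne[OF prim s(1), of "k + 1"] by simp
    moreover have "Suc k div d = k div d"
      using False by (simp add: div_Suc dvd_eq_mod_eq_0)
    then have "(\<Prod>i<Suc k. 1 - qvar ^ (s * (i + 1))) = to_fract [:- z, 1:] ^ (Suc k div d) * (U * (1 - qvar ^ (s * (k + 1))))"
      unfolding prod.lessThan_Suc U(1) by (simp only: mult_ac)
    moreover have "has_value z (U * (1 - qvar ^ (s * (k + 1)))) (c * (1 - z ^ (s * (k + 1))))"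
      using U by (intro has_value_mult has_value_one_minus_power)
    ultimately show ?thesis
      using U(3) by (intro exI[of _ "U * (1 - qvar ^ (s * (k + 1)))"] exI[of _ "c * (1 - z ^ (s * (k + 1)))"]) simp
  qed
qed

lemma ord_ge_0_qpoch_ratio:
  assumes prim: "primitive_root z d" and s: "coprime s d" and s': "coprime s' d" "s' > 0" and d: "d > 0"
  shows "ord_ge z 0 ((\<Prod>i<k. 1 - qvar ^ (s * i + e)) / (\<Prod>i<k. 1 - qvar ^ (s' * (i + 1))))"
proof -
  obtain U c where U: "(\<Prod>i<k. 1 - qvar ^ (s' * (i + 1))) = to_fract [:- z, 1:] ^ (k div d) * U"
    "has_value z U c" "c \<noteq> 0"
    using prod_one_minus_power_exact[OF prim s' d] by blast
  obtain g b where g: "has_value z g b" "(\<Prod>i<k. 1 - qvar ^ (s * i + e)) = to_fract [:- z, 1:] ^ (k div d) * g"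
    using ord_ge_prod_one_minus_power[OF prim s d] unfolding ord_ge_def by blast
  have "to_fract [:- z, 1:] ^ (k div d) \<noteq> 0" by simp
  then have "(\<Prod>i<k. 1 - qvar ^ (s * i + e)) / (\<Prod>i<k. 1 - qvar ^ (s' * (i + 1))) = g / U"
    unfolding U(1) g(2) by simp
  then show ?thesis
    using has_value_divide[OF g(1) U(2,3)] has_value_imp_ord_ge_0 by simp
qed

text \<open>Each shifted factorial in the numerator is paired with one of the same length in the
  denominator, which has no more zeros at \<open>z\<close>.\<close>

lemma ord_ge_0_gterm:
  assumes prim: "primitive_root z d" and d: "odd d"
  shows "ord_ge z 0 (gterm k)"
proof -
  have cop: "coprime 2 d" "coprime 4 d" using odd_imp_coprime_powers_of_two[OF d] .
  have d0: "d > 0" using d by (rule odd_pos)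
  have i4: "4 * (j + 1) = 4 * j + 4" "2 * (j + 1) = 2 * j + 2" for j :: nat
    by simp_all
  have "gterm k = ((\<Prod>j<k. 1 - qvar ^ (4 * j + 1)) / (\<Prod>j<k. 1 - qvar ^ (2 * (j + 1))))
      * ((\<Prod>j<k. 1 - qvar ^ (2 * j + 1)) / (\<Prod>j<k. 1 - qvar ^ (4 * (j + 1)))) ^ 3 * (\<Prod>j<k. qvar ^ (2 * j + 2))"
    unfolding gterm_def prod_power_distrib prod.distrib prod_dividef power_divide i4
    by (simp add: ac_simps del: power_Suc)
  moreover have "ord_ge z 0 (\<Prod>j<k. qvar ^ (2 * j + 2))"
    by (rule has_value_imp_ord_ge_0, rule has_value_prod, rule has_value_power, rule has_value_qvar)
  moreover have "ord_ge z 0 (((\<Prod>j<k. 1 - qvar ^ (2 * j + 1)) / (\<Prod>j<k. 1 - qvar ^ (4 * (j + 1)))) ^ 3)"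
    by (rule ord_ge_power[where k = 0 and l = 3, unfolded mult_0], rule ord_ge_0_qpoch_ratio[OF prim cop(1) cop(2) _ d0]) simp
  moreover have "ord_ge z 0 ((\<Prod>j<k. 1 - qvar ^ (4 * j + 1)) / (\<Prod>j<k. 1 - qvar ^ (2 * (j + 1))))"
    by (rule ord_ge_0_qpoch_ratio[OF prim cop(2) cop(1) _ d0]) simp
  ultimately show ?thesis
    by (simp only: ord_ge_mult_0)
qed

text \<open>With \<open>k = l * d + r\<close> the summand at \<open>z\<close> becomes
  \<open>\<gamma> l * y r\<close>, because \<open>z ^ d = 1\<close>. Every block then contains the
  sum of the \<open>y r\<close>, which vanishes by the case \<open>n = d\<close>.\<close>

lemma ord_ge_1_sum_gterm:
  assumes prim: "primitive_root z d" and d: "odd d" "d > 1" and n: "n = d * (2 * L + 1)"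
  shows "ord_ge z 1 (\<Sum>k\<le>(n - 1) div 2. (1 - qvar ^ (6 * k + 1)) * gterm k)"
proof -
  define h where "h = (d - 1) div 2"
  define rho where "rho = (\<lambda>j. (1 - qvar ^ (4 * j + 1)) * (1 - qvar ^ (2 * j + 1)) ^ 3 * qvar ^ (2 * j + 2)
     / ((1 - qvar ^ (2 * j + 2)) * (1 - qvar ^ (4 * j + 4)) ^ 3))"
  define v where "v = (\<lambda>r. \<Prod>j<r. (1 - z ^ (4 * j + 1)) * (1 - z ^ (2 * j + 1)) ^ 3 * z ^ (2 * j + 2)
     / ((1 - z ^ (2 * j + 2)) * (1 - z ^ (4 * j + 4)) ^ 3))"
  define y where "y = (\<lambda>r. (1 - z ^ (6 * r + 1)) * v r)"
  let ?T = "\<lambda>k. (1 - qvar ^ (6 * k + 1)) * gterm k"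
  have dh: "d = 2 * h + 1" using d by (auto simp: h_def elim: oddE)
  have zd: "z ^ (s * (l * d + i) + e) = z ^ (s * i + e)" for s l i e
  proof -
    have "z ^ (s * (l * d + i) + e) = (z ^ d) ^ (s * l) * z ^ (s * i + e)"
      unfolding power_mult[symmetric] power_add[symmetric] by (simp add: algebra_simps)
    then show ?thesis using prim by simp
  qed
  have ne: "1 - z ^ (2 * (j + 1)) \<noteq> 0" "1 - z ^ (4 * (j + 1)) \<noteq> 0" if "j + 1 < d" for j
  proof -
    have "\<not> d dvd (j + 1)" using that by (auto dest!: dvd_imp_le)
    then show "1 - z ^ (2 * (j + 1)) \<noteq> 0" "1 - z ^ (4 * (j + 1)) \<noteq> 0"
      using primitive_root_ne[OF prim] odd_imp_coprime_powers_of_two[OF d(1)] by blast+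
  qed
  have val: "has_value z (\<Prod>i<r. rho (l * d + i)) (v r)" if "r < d" for l r
    unfolding v_def
  proof (rule has_value_prod)
    fix i assume "i \<in> {..<r}"
    then have i: "i + 1 < d" using that by simp
    have ne': "1 - z ^ (2 * (l * d + i) + 2) \<noteq> 0" "1 - z ^ (4 * (l * d + i) + 4) \<noteq> 0"
      unfolding zd using ne[OF i] by (simp_all add: algebra_simps)
    have "has_value z (rho (l * d + i))
      ((1 - z ^ (4 * (l * d + i) + 1)) * (1 - z ^ (2 * (l * d + i) + 1)) ^ 3 * z ^ (2 * (l * d + i) + 2)
     / ((1 - z ^ (2 * (l * d + i) + 2)) * (1 - z ^ (4 * (l * d + i) + 4)) ^ 3))"
      unfolding rho_def using ne'
      by (intro has_value_intros) simp
    then show "has_value z (rho (l * d + i))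
      ((1 - z ^ (4 * i + 1)) * (1 - z ^ (2 * i + 1)) ^ 3 * z ^ (2 * i + 2)
     / ((1 - z ^ (2 * i + 2)) * (1 - z ^ (4 * i + 4)) ^ 3))"
      unfolding zd .
  qed
  define \<gamma> where "\<gamma> = (\<lambda>l. SOME c. has_value z (gterm (l * d)) c)"
  have \<gamma>: "has_value z (gterm (l * d)) (\<gamma> l)" for l
    unfolding \<gamma>_def by (rule someI_ex) (rule ord_ge_0_gterm[OF prim d(1), unfolded ord_ge_0_iff])
  have T: "has_value z (?T (l * d + r)) (\<gamma> l * y r)" if "r < d" for l r
  proof -
    have "gterm (l * d + r) = gterm (l * d) * (\<Prod>i<r. rho (l * d + i))"
      unfolding gterm_def rho_def by (rule prod_lessThan_add)
    then have "?T (l * d + r) = gterm (l * d) * ((1 - qvar ^ (6 * (l * d + r) + 1)) * (\<Prod>i<r. rho (l * d + i)))"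
      by (simp only: mult_ac)
    moreover have "has_value z (gterm (l * d) * ((1 - qvar ^ (6 * (l * d + r) + 1)) * (\<Prod>i<r. rho (l * d + i))))
       (\<gamma> l * ((1 - z ^ (6 * (l * d + r) + 1)) * v r))"
      by (intro has_value_mult \<gamma> has_value_one_minus_power val that)
    ultimately show ?thesis unfolding y_def zd by (simp only:)
  qed
  have y0: "(\<Sum>r\<le>h. y r) = 0"
  proof -
    have "has_value z (\<Sum>r\<le>h. ?T (0 * d + r)) (\<Sum>r\<le>h. \<gamma> 0 * y r)"
      using dh by (intro has_value_sum T) auto
    moreover have "\<gamma> 0 = 1"
      by (rule has_value_unique[OF \<gamma>[of 0]]) (simp add: gterm_def)
    ultimately have "has_value z (\<Sum>r\<le>h. ?T r) (\<Sum>r\<le>h. y r)"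
      by simp
    then show ?thesis
      by (rule has_value_unique) (unfold h_def, rule has_value_sum_gterm[OF prim d])
  qed
  \<comment> \<open>The factor at \<open>j = h\<close> contains
    \<open>1 - z ^ (2 * h + 1) = 1 - z ^ d = 0\<close>, so a full block agrees with its truncation
    at \<open>h\<close>.\<close>
  have y_big: "y r = 0" if "h < r" for r
  proof -
    have "z ^ (2 * h + 1) = 1" using primitive_root_power[OF prim] unfolding dh .
    then have "(1 - z ^ (4 * h + 1)) * (1 - z ^ (2 * h + 1)) ^ 3 * z ^ (2 * h + 2)
       / ((1 - z ^ (2 * h + 2)) * (1 - z ^ (4 * h + 4)) ^ 3) = 0"
      by (simp only: diff_self) simp
    then have "v r = 0"
      unfolding v_def using that by (intro prod_zero bexI[of _ h]) auto
    then show ?thesis by (simp add: y_def)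
  qed
  have yd: "(\<Sum>r<d. y r) = 0"
  proof -
    have "(\<Sum>r<d. y r) = (\<Sum>r\<le>h. y r)"
      using dh by (intro sum.mono_neutral_right) (auto simp: y_big)
    then show ?thesis using y0 by simp
  qed
  \<comment> \<open>The range ends with \<open>r = h\<close> in block \<open>L\<close>, so the
    incomplete last block is such a truncation and vanishes too.\<close>
  have idx: "(n - 1) div 2 = L * d + h"
    using n dh by (simp add: algebra_simps)
  have split: "(\<Sum>k\<le>(n - 1) div 2. ?T k)
      = (\<Sum>l<L. \<Sum>r<d. ?T (l * d + r)) + (\<Sum>r\<le>h. ?T (L * d + r))"
    using sum_lessThan_add[of ?T "L * d" "Suc h"]
    unfolding idx sum_lessThan_blocks add_Suc_right lessThan_Suc_atMost .
  have "has_value z (\<Sum>k\<le>(n - 1) div 2. ?T k) ((\<Sum>l<L. \<Sum>r<d. \<gamma> l * y r) + (\<Sum>r\<le>h. \<gamma> L * y r))"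
    unfolding split using dh by (intro has_value_add has_value_sum T) auto
  also have "(\<Sum>l<L. \<Sum>r<d. \<gamma> l * y r) + (\<Sum>r\<le>h. \<gamma> L * y r) = 0"
    by (simp add: sum_distrib_left[symmetric] y0 yd)
  finally show ?thesis by (rule has_value_0_imp_ord_ge_1)
qed

section \<open>Sums and products over roots of unity\<close>

text \<open>A finite Fourier expansion. The coefficients are quadratic in \<open>k\<close>, so
  multiplication by \<open>(1 - y) ^ 3\<close> takes third differences and leaves only boundary
  terms, stated as \<open>part\<close> for every length \<open>m\<close>.\<close>

lemma root_of_unity_partial_fraction:
  fixes y :: complex
  assumes y: "y ^ n = 1" "y \<noteq> 1" and n: "n > 0"
  shows "2 * of_nat n * (y / (1 - y) ^ 2) = (\<Sum>k<n. of_nat k * (of_nat n - of_nat k) * y ^ k)"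
proof -
  define N where "N = (of_nat n :: complex)"
  define a where "a = (\<lambda>x. x * (N - x))"
  have part: "(1 - y) ^ 3 * (\<Sum>k<m. a (of_nat k) * y ^ k) = (N - 1) * y - (N + 1) * y ^ 2
     - y ^ m * (a (of_nat m) + (a (of_nat m + 1) - 3 * a (of_nat m)) * y
        + (a (of_nat m + 2) - 3 * a (of_nat m + 1) + 3 * a (of_nat m)) * y ^ 2)" for m
  proof (induction m)
    case 0
    show ?case by (simp add: a_def algebra_simps power2_eq_square)
  next
    case (Suc m)
    have "(1 - y) ^ 3 * (\<Sum>k<Suc m. a (of_nat k) * y ^ k)
        = (1 - y) ^ 3 * (\<Sum>k<m. a (of_nat k) * y ^ k) + (1 - y) ^ 3 * (a (of_nat m) * y ^ m)"
      by (simp add: distrib_left)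
    also have "\<dots> = (N - 1) * y - (N + 1) * y ^ 2
     - y ^ Suc m * (a (of_nat (Suc m)) + (a (of_nat (Suc m) + 1) - 3 * a (of_nat (Suc m))) * y
        + (a (of_nat (Suc m) + 2) - 3 * a (of_nat (Suc m) + 1) + 3 * a (of_nat (Suc m))) * y ^ 2)"
      unfolding Suc.IH by (simp add: a_def algebra_simps power2_eq_square power3_eq_cube)
    finally show ?case .
  qed
  have y1: "1 - y \<noteq> 0" using y(2) by simp
  have aN: "a N = 0" "a (N + 1) = - (N + 1)" "a (N + 2) = - 2 * (N + 2)"
    by (simp_all add: a_def algebra_simps)
  have "(1 - y) ^ 3 * (\<Sum>k<n. a (of_nat k) * y ^ k) = 2 * N * y * (1 - y)"
    unfolding part[of n] N_def[symmetric] aN y(1) by (simp add: algebra_simps power2_eq_square)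
  then have "(1 - y) * ((1 - y) ^ 2 * (\<Sum>k<n. a (of_nat k) * y ^ k)) = (1 - y) * (2 * N * y)"
    by (simp add: power3_eq_cube power2_eq_square mult_ac)
  then have "(1 - y) ^ 2 * (\<Sum>k<n. a (of_nat k) * y ^ k) = 2 * N * y"
    using y1 by (simp only: mult_cancel_left) simp
  then show ?thesis
    using y1 by (simp add: a_def N_def field_simps)
qed

lemma sum_powers_root_of_unity:
  fixes y :: complex
  assumes "y ^ n = 1" "y \<noteq> 1"
  shows "(\<Sum>j<n. y ^ j) = 0"
  using assms by (simp add: geometric_sum)

text \<open>After expansion and exchange of sums, the inner sum over \<open>j\<close> is
  \<open>-1\<close> for each \<open>k \<noteq> 0\<close>, and the coefficient at
  \<open>k = 0\<close> is zero. What remains is the sum of \<open>k * (n - k)\<close>.\<close>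

lemma sum_inverse_square_chord:
  assumes prim: "primitive_root y n" and n: "n > 0"
  shows "(\<Sum>j=1..<n. y ^ j / (1 - y ^ j) ^ 2) = - (of_nat n ^ 2 - 1) / 12"
proof -
  define N where "N = (of_nat n :: complex)"
  have N: "N \<noteq> 0" using n by (simp add: N_def)
  let ?a = "\<lambda>k. of_nat k * (N - of_nat k) :: complex"
  have "2 * N * (\<Sum>j=1..<n. y ^ j / (1 - y ^ j) ^ 2) = (\<Sum>j=1..<n. \<Sum>k<n. ?a k * (y ^ j) ^ k)"
    unfolding sum_distrib_left
  proof (rule sum.cong[OF refl])
    fix j assume j: "j \<in> {1..<n}"
    have "(y ^ j) ^ n = 1"
      using prim by (simp add: primitive_root_def power_mult[symmetric])
    moreover have "y ^ j \<noteq> 1"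
      using prim j by (auto simp: primitive_root_def dest: dvd_imp_le)
    ultimately show "2 * N * (y ^ j / (1 - y ^ j) ^ 2) = (\<Sum>k<n. ?a k * (y ^ j) ^ k)"
      unfolding N_def using n by (rule root_of_unity_partial_fraction)
  qed
  also have "\<dots> = (\<Sum>k<n. ?a k * (\<Sum>j=1..<n. (y ^ k) ^ j))"
    unfolding sum_distrib_left
    by (subst sum.swap) (simp add: power_mult[symmetric] mult.commute[of _ "_ :: nat"])
  also have "\<dots> = (\<Sum>k<n. - ?a k)"
  proof (rule sum.cong[OF refl])
    fix k assume k: "k \<in> {..<n}"
    show "?a k * (\<Sum>j=1..<n. (y ^ k) ^ j) = - ?a k"
    proof (cases "k = 0")
      case False
      have "(y ^ k) ^ n = 1"
        using prim by (simp add: primitive_root_def power_mult[symmetric])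
      moreover have "y ^ k \<noteq> 1"
        using prim k False by (auto simp: primitive_root_def dest: dvd_imp_le)
      ultimately have "(\<Sum>j<n. (y ^ k) ^ j) = 0"
        by (rule sum_powers_root_of_unity)
      moreover have "(\<Sum>j<n. (y ^ k) ^ j) = 1 + (\<Sum>j=1..<n. (y ^ k) ^ j)"
        using n by (simp add: atLeast0LessThan[symmetric] sum.atLeast_Suc_lessThan)
      ultimately have "(\<Sum>j=1..<n. (y ^ k) ^ j) = - 1"
        by (simp add: add_eq_0_iff)
      then show ?thesis by simp
    qed simp
  qed
  also have "\<dots> = - (N * (N ^ 2 - 1) / 6)"
  proof -
    \<comment> \<open>The length \<open>m\<close> is separated from the parameter \<open>N\<close>
      so that induction is possible; then \<open>m = n\<close>.\<close>
    have closed: "(\<Sum>k<m. of_nat k * (N - of_nat k)) = of_nat m * (of_nat m - 1) * (3 * N - 2 * of_nat m + 1) / (6 :: complex)" for m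
      by (induction m) (simp_all add: field_simps)
    show ?thesis
      unfolding sum_negf closed N_def[symmetric] by (simp add: field_simps power2_eq_square)
  qed
  also have "\<dots> = 2 * N * (- (N ^ 2 - 1) / 12)"
    by (simp add: field_simps)
  finally show ?thesis
    using N unfolding N_def by (simp only: mult_cancel_left) simp
qed

text \<open>The summand is invariant under \<open>j \<mapsto> n - j\<close> for
  \<open>n = 2 * h + 1\<close>, so the half sum is half of the full one.\<close>

lemma sum_half_inverse_square_chord:
  assumes prim: "primitive_root y (2 * h + 1)"
  shows "(\<Sum>j<h. y ^ (j + 1) / (1 - y ^ (j + 1)) ^ 2) = - (of_nat (2 * h + 1) ^ 2 - 1) / 24"
proof -
  let ?n = "2 * h + 1"
  let ?f = "\<lambda>j. y ^ j / (1 - y ^ j) ^ 2"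
  have y: "y \<noteq> 0" using primitive_root_nonzero[OF prim] by simp
  have sym: "?f (?n - j) = ?f j" if "j \<le> ?n" "\<not> ?n dvd j" for j
  proof -
    have "y ^ (?n - j) * y ^ j = 1"
      using that(1) prim by (simp add: power_add[symmetric] primitive_root_def del: power_Suc)
    then have e: "y ^ (?n - j) = 1 / y ^ j"
      using y by (simp add: field_simps del: power_Suc)
    have "y ^ j \<noteq> 1" using prim that(2) by (simp add: primitive_root_def)
    then show ?thesis
      unfolding e using y by (simp add: field_simps power2_eq_square)
  qed
  have "(\<Sum>j=1..<?n. ?f j) = (\<Sum>j<2 * h. ?f (j + 1))"
    using sum.shift_bounds_nat_ivl[of ?f 0 1 "2 * h"] by (simp add: atLeast0LessThan)
  also have "\<dots> = (\<Sum>j<h. ?f (j + 1)) + (\<Sum>j<h. ?f (h + j + 1))"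
    using sum_lessThan_add[of "\<lambda>j. ?f (j + 1)" h h] by (simp add: mult_2)
  also have "(\<Sum>j<h. ?f (h + j + 1)) = (\<Sum>j<h. ?f (h + (h - Suc j) + 1))"
    by (rule sum.nat_diff_reindex[symmetric])
  also have "\<dots> = (\<Sum>j<h. ?f (j + 1))"
  proof (rule sum.cong[OF refl])
    fix j assume j: "j \<in> {..<h}"
    then have "h + (h - Suc j) + 1 = ?n - (j + 1)" by auto
    moreover have "\<not> ?n dvd (j + 1)" using j by (auto dest!: dvd_imp_le)
    ultimately show "?f (h + (h - Suc j) + 1) = ?f (j + 1)"
      using sym[of "j + 1"] j by simp
  qed
  finally have "2 * (\<Sum>j<h. ?f (j + 1)) = - (of_nat ?n ^ 2 - 1) / 12"
    using sum_inverse_square_chord[OF prim] by simp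
  then show ?thesis by (simp add: field_simps)
qed

lemma primitive_root_square:
  assumes "primitive_root z n" "odd n"
  shows "primitive_root (z ^ 2) n"
  using assms odd_imp_coprime_powers_of_two[of n]
  by (simp add: primitive_root_def power_mult[symmetric] coprime_commute coprime_dvd_mult_right_iff)

text \<open>Reversing the order of the factors and using \<open>1 - x = - x * (1 - 1 / x)\<close>
  exchanges the residue classes 3 and 2, and likewise 1 and 4, since \<open>s + t = 5\<close> makes
  the exponents add up to \<open>4 * m + 1\<close>.\<close>

lemma prod_root_of_unity_reflect:
  assumes prim: "primitive_root z (4 * m + 1)"
  shows "(\<Prod>i<m. 1 - z ^ (4 * i + 3)) * (\<Prod>i<m. 1 - z ^ (4 * i + 1)) * z ^ m
    = (\<Prod>i<m. 1 - z ^ (4 * i + 2)) * (\<Prod>i<m. 1 - z ^ (4 * i + 4))"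
proof -
  have zn: "z ^ (4 * m + 1) = 1" using primitive_root_power[OF prim] .
  have refl: "(\<Prod>i<m. 1 - z ^ (4 * i + s)) = (\<Prod>i<m. - (z ^ (4 * i + s))) * (\<Prod>i<m. 1 - z ^ (4 * i + t))"
    if "s + t = 5" for s t
  proof -
    have reindex: "(\<Prod>i<m. 1 - z ^ (4 * i + t)) = (\<Prod>i<m. 1 - z ^ (4 * (m - Suc i) + t))"
      by (rule prod.nat_diff_reindex[symmetric])
    have factor: "1 - z ^ (4 * i + s) = - (z ^ (4 * i + s)) * (1 - z ^ (4 * (m - Suc i) + t))" if "i < m" for i
    proof -
      have "(4 * i + s) + (4 * (m - Suc i) + t) = 4 * m + 1"
        using that \<open>s + t = 5\<close> by simp
      then have "z ^ (4 * i + s) * z ^ (4 * (m - Suc i) + t) = 1"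
        unfolding power_add[symmetric] using zn by (simp only:)
      then show ?thesis by (simp add: right_diff_distrib)
    qed
    show ?thesis
      unfolding reindex prod.distrib[symmetric] by (intro prod.cong refl factor) simp
  qed
  \<comment> \<open>The signs cancel in pairs and the exponents add up to
    \<open>4 * m ^ 2 + m = m * (4 * m + 1)\<close>.\<close>
  have "(\<Prod>i<m. - (z ^ (4 * i + 3))) * (\<Prod>i<m. - (z ^ (4 * i + 1))) * z ^ m = (z ^ (4 * m + 1)) ^ m"
  proof -
    have "(\<Prod>i<k. - (z ^ (4 * i + 3))) * (\<Prod>i<k. - (z ^ (4 * i + 1))) = z ^ (4 * k * k)" for k
    proof (induction k)
      case (Suc k)
      have "4 * Suc k * Suc k = 4 * k * k + ((4 * k + 3) + (4 * k + 1))" by (simp add: algebra_simps)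
      then have "z ^ (4 * Suc k * Suc k) = z ^ (4 * k * k) * (z ^ (4 * k + 3) * z ^ (4 * k + 1))"
        by (simp only: power_add)
      then show ?case
        unfolding prod.lessThan_Suc Suc.IH[symmetric] by (simp only:) simp
    qed simp
    then show ?thesis
      by (simp add: power_mult[symmetric] power_add[symmetric] algebra_simps)
  qed
  then have "(\<Prod>i<m. - (z ^ (4 * i + 3))) * (\<Prod>i<m. - (z ^ (4 * i + 1))) * z ^ m = 1"
    unfolding zn by simp
  moreover have "L3 * X2 * (L1 * X4) * z ^ m = X2 * X4" if "L3 * L1 * z ^ m = 1" for L3 X2 L1 X4
  proof -
    have "L3 * X2 * (L1 * X4) * z ^ m = (L3 * L1 * z ^ m) * (X2 * X4)" by (simp only: mult_ac)
    then show ?thesis using that by simp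
  qed
  moreover have "(3::nat) + 2 = 5" "(1::nat) + 4 = 5" by simp_all
  ultimately show ?thesis
    using refl[of 3 2] refl[of 1 4] by (simp only:)
qed

section \<open>Comparison of the vertices at a primitive root\<close>

text \<open>\<open>G\<close> absorbs all higher powers of \<open>\<tau>\<close>; since
  \<open>\<tau>\<close> vanishes at \<open>z\<close>, the value of \<open>G\<close> is just the
  first order coefficient.\<close>

lemma prod_one_minus_small:
  fixes m :: nat
  assumes \<tau>: "has_value z \<tau> 0" and \<sigma>: "\<And>j. j < m \<Longrightarrow> has_value z (\<sigma> j) (s j)"
  shows "\<exists>G. (\<Prod>j<m. 1 - \<tau> * \<sigma> j) = 1 - \<tau> * G \<and> has_value z G (\<Sum>j<m. s j)"
  using \<sigma>
proof (induction m)
  case 0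
  show ?case by (intro exI[of _ 0]) simp
next
  case (Suc m)
  then obtain G where G: "(\<Prod>j<m. 1 - \<tau> * \<sigma> j) = 1 - \<tau> * G" "has_value z G (\<Sum>j<m. s j)"
    by auto
  have "(\<Prod>j<Suc m. 1 - \<tau> * \<sigma> j) = 1 - \<tau> * (G + \<sigma> m - \<tau> * (G * \<sigma> m))"
    unfolding prod.lessThan_Suc G(1) by (simp add: algebra_simps)
  moreover have "has_value z (G + \<sigma> m - \<tau> * (G * \<sigma> m)) ((\<Sum>j<m. s j) + s m - 0 * ((\<Sum>j<m. s j) * s m))"
    by (intro has_value_add has_value_diff has_value_mult G \<tau> Suc.prems) simp_all
  ultimately show ?case by (intro exI conjI) simp_all
qed

text \<open>Factor by factor, \<open>(1 - y / r) * (1 - y * r)\<close> is \<open>(1 - y) ^ 2\<close>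
  times a correction with the second order factor \<open>(1 - r) ^ 2 / r\<close>. The closed form
  then exhibits \<open>1 - qvar ^ n\<close> by a shift of the exponents
  \<open>4 * j + 5\<close>.\<close>

lemma vertex_shifted_w_ratio:
  assumes n: "n = 4 * m + 1"
  shows "vertex n False True True * (\<Prod>j<m. 1 - (1 - qvar ^ n) ^ 2 / qvar ^ n * (qvar ^ (4 * j + 4) / (1 - qvar ^ (4 * j + 4)) ^ 2))
    = vertex n False True False"
    and "vertex n False True False = (1 - qvar ^ n) * ((\<Prod>j<m. 1 - qvar ^ (4 * j + 3)) * (\<Prod>j<m. 1 - qvar ^ (4 * j + 1))
      / (\<Prod>j<m. 1 - qvar ^ (4 * j + 4)) ^ 2)"
proof -
  let ?q = qvar
  have y_ne: "1 - ?q ^ (4 * j + 4) \<noteq> 0" for j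
    by (rule one_minus_qvar_power_nonzero) simp
  have fac: "(1 - y / r) * (1 - y * r) = (1 - y) ^ 2 * (1 - (1 - r) ^ 2 / r * (y / (1 - y) ^ 2))"
    if "r \<noteq> 0" "1 - y \<noteq> 0" for r y :: ratfun
  proof -
    have "(1 - y) ^ 2 * (1 - (1 - r) ^ 2 / r * (y / (1 - y) ^ 2)) = (1 - y) ^ 2 - (1 - r) ^ 2 / r * y"
      using that by (simp add: right_diff_distrib)
    also have "\<dots> = (1 - y / r) * (1 - y * r)"
      using that(1) by (simp add: field_simps power2_eq_square)
    finally show ?thesis by simp
  qed
  have ne: "(1 - ?q ^ (4 * j + 4) / ?q ^ n) * (1 - ?q ^ (4 * j + 4) * ?q ^ n) \<noteq> 0" for j
  proof -
    have "4 * j + 4 \<noteq> n" using n by presburger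
    then show ?thesis
      using qvar_ratio_ne_one[of "4 * j + 4" n] one_minus_qvar_power_nonzero[of "4 * j + 4 + n"]
      unfolding power_add[of _ "4 * j + 4" n] by simp
  qed
  show "vertex n False True True * (\<Prod>j<m. 1 - (1 - ?q ^ n) ^ 2 / ?q ^ n * (?q ^ (4 * j + 4) / (1 - ?q ^ (4 * j + 4)) ^ 2))
    = vertex n False True False"
    unfolding vertex_shifted_w[OF n] if_True if_False mult.assoc prod.distrib[symmetric]
  proof (intro arg_cong[where f = "\<lambda>x. (1 - ?q) * x"] prod.cong refl)
    fix j
    let ?y = "?q ^ (4 * j + 4)"
    let ?N = "(1 - ?q ^ (4 * j + 3)) * (1 - ?q ^ (4 * j + 5))"
    let ?s = "1 - (1 - ?q ^ n) ^ 2 / ?q ^ n * (?y / (1 - ?y) ^ 2)"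
    have f: "(1 - ?y / ?q ^ n) * (1 - ?y * ?q ^ n) = (1 - ?y) ^ 2 * ?s"
      using y_ne by (intro fac) simp_all
    then have "?s \<noteq> 0" using ne[of j] by auto
    then show "?N / ((1 - ?y / ?q ^ n) * (1 - ?y * ?q ^ n)) * ?s = ?N / ((1 - ?y / 1) * (1 - ?y * 1))"
      unfolding f by (simp add: power2_eq_square)
  qed
  have "(1 - ?q) * (\<Prod>j<m. 1 - ?q ^ (4 * j + 5)) = (\<Prod>j<Suc m. 1 - ?q ^ (4 * j + 1))"
  proof -
    have "4 * Suc j + 1 = 4 * j + 5" for j :: nat by simp
    then show ?thesis unfolding prod.lessThan_Suc_shift by (simp only:) simp
  qed
  also have "\<dots> = (1 - ?q ^ n) * (\<Prod>j<m. 1 - ?q ^ (4 * j + 1))"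
    by (simp add: n)
  finally have sh: "(1 - ?q) * (\<Prod>j<m. 1 - ?q ^ (4 * j + 5)) = (1 - ?q ^ n) * (\<Prod>j<m. 1 - ?q ^ (4 * j + 1))" .
  have "vertex n False True False = (\<Prod>j<m. 1 - ?q ^ (4 * j + 3)) * ((1 - ?q) * (\<Prod>j<m. 1 - ?q ^ (4 * j + 5)))
     / (\<Prod>j<m. 1 - ?q ^ (4 * j + 4)) ^ 2"
    unfolding vertex_shifted_w[OF n] if_False prod_dividef prod.distrib div_by_1 mult_1_right power2_eq_square
    by (simp only: times_divide_eq_right mult_ac)
  then show "vertex n False True False = (1 - ?q ^ n) * ((\<Prod>j<m. 1 - ?q ^ (4 * j + 3)) * (\<Prod>j<m. 1 - ?q ^ (4 * j + 1))
      / (\<Prod>j<m. 1 - ?q ^ (4 * j + 4)) ^ 2)"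
    unfolding sh by (simp only: times_divide_eq_right mult_ac)
qed

text \<open>The vertex with shifted \<open>(u, v)\<close> alone supplies the main term. The two
  vertices with shifted \<open>w\<close> differ by a multiple of \<open>(1 - qvar ^ n) ^ 3\<close>,
  which must match the term with \<open>B\<close> to one more order.\<close>

lemma ord_ge_4_main:
  assumes prim: "primitive_root z n" and n: "n = 4 * m + 1" and m: "m > 0"
  defines "Q \<equiv> (\<Prod>i<m. (1 - qvar ^ (4 * i + 2)) / (1 - qvar ^ (4 * i + 4)))"
  shows "ord_ge z 4 (vertex n False False False
    - (1 - qvar ^ n) / qvar ^ m * Q * (1 + qint qvar n ^ 2 * B n qvar))"
proof -
  let ?q = qvar
  let ?r = "qvar ^ n"
  let ?\<tau> = "(1 - ?r) ^ 2 / ?r"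
  let ?\<sigma> = "\<lambda>j. ?q ^ (4 * j + 4) / (1 - ?q ^ (4 * j + 4)) ^ 2"
  let ?s = "\<lambda>j. z ^ (4 * j + 4) / (1 - z ^ (4 * j + 4)) ^ 2"
  have odd: "odd n" and n1: "n > 1" using n m by simp_all
  have z0: "z \<noteq> 0" using primitive_root_nonzero[OF prim] n by simp
  have nd: "\<not> n dvd (k + 1)" if "k < 2 * m" for k
    using that n by (auto dest!: dvd_imp_le)
  have ne4: "1 - z ^ (4 * j + 4) \<noteq> 0" if "j < m" for j
    using primitive_root_ne[OF prim _ nd, of 4 j] odd_imp_coprime_powers_of_two[OF odd] that
    by (simp add: algebra_simps)
  have ne2: "1 - z ^ (4 * j + 2) \<noteq> 0" if "j < m" for j
    using primitive_root_ne[OF prim _ nd, of 2 "2 * j"] odd_imp_coprime_powers_of_two[OF odd] that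
    by (simp add: algebra_simps)
  have v_r: "has_value z ?r 1"
    using has_value_power[OF has_value_qvar, of z n] prim by simp
  have v_\<tau>: "has_value z ?\<tau> 0"
    using has_value_divide[OF has_value_power[OF has_value_diff[OF has_value_1 v_r], of 2] v_r] by simp
  have v_\<sigma>: "has_value z (?\<sigma> j) (?s j)" if "j < m" for j
    using ne4[OF that] by (intro has_value_intros) simp
  obtain G where G: "(\<Prod>j<m. 1 - ?\<tau> * ?\<sigma> j) = 1 - ?\<tau> * G" "has_value z G (\<Sum>j<m. ?s j)"
    using prod_one_minus_small[where m = m and \<sigma> = ?\<sigma> and s = ?s, OF v_\<tau> v_\<sigma>] by blast
  define Y where "Y = (\<Prod>j<m. 1 - ?q ^ (4 * j + 3)) * (\<Prod>j<m. 1 - ?q ^ (4 * j + 1))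
      / (\<Prod>j<m. 1 - ?q ^ (4 * j + 4)) ^ 2"
  define Qz where "Qz = (\<Prod>i<m. (1 - z ^ (4 * i + 2)) / (1 - z ^ (4 * i + 4)))"
  have v_Q: "has_value z Q Qz"
    unfolding Q_def Qz_def using ne4 by (intro has_value_prod has_value_divide has_value_one_minus_power) simp_all
  have D: "(\<Prod>j<m. 1 - z ^ (4 * j + 4)) \<noteq> 0"
    using ne4 by (subst prod_zero_iff) (auto simp del: power_Suc)
  have "has_value z Y ((\<Prod>j<m. 1 - z ^ (4 * j + 3)) * (\<Prod>j<m. 1 - z ^ (4 * j + 1))
      / (\<Prod>j<m. 1 - z ^ (4 * j + 4)) ^ 2)"
    unfolding Y_def using D by (intro has_value_intros) simp
  \<comment> \<open>By reflection, both prefactors, \<open>Y\<close> and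
    \<open>Q / qvar ^ m\<close>, have the same value at \<open>z\<close>.\<close>
  also have "(\<Prod>j<m. 1 - z ^ (4 * j + 3)) * (\<Prod>j<m. 1 - z ^ (4 * j + 1))
      / (\<Prod>j<m. 1 - z ^ (4 * j + 4)) ^ 2 = Qz / z ^ m"
    using prod_root_of_unity_reflect[of z m] prim D z0 unfolding n Qz_def prod_dividef
    by (simp add: field_simps power2_eq_square)
  finally have v_Y: "has_value z Y (Qz / z ^ m)" .
  define b where "b = (of_nat n ^ 2 - 1) / 24 + (\<Sum>k=1..(n - 1) div 4. z ^ (4 * k - 2) / (1 - z ^ (4 * k - 2)) ^ 2)"
  have Bq: "B n ?q / (1 - ?q) ^ 2 = (of_nat n ^ 2 - 1) / 24
      + (\<Sum>k=1..(n - 1) div 4. ?q ^ (4 * k - 2) / (1 - ?q ^ (4 * k - 2)) ^ 2)"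
  proof -
    have "B n ?q = ((of_nat n ^ 2 - 1) / 24
      + (\<Sum>k=1..(n - 1) div 4. ?q ^ (4 * k - 2) / (1 - ?q ^ (4 * k - 2)) ^ 2)) * (1 - ?q) ^ 2"
      unfolding B_def qint_def distrib_right sum_distrib_right power_divide
      by (simp only: divide_divide_eq_right times_divide_eq_left times_divide_eq_right)
    then show ?thesis by simp
  qed
  have v_B: "has_value z (B n ?q / (1 - ?q) ^ 2) b"
    unfolding Bq b_def
  proof (intro has_value_add has_value_divide has_value_diff has_value_sum has_value_power has_value_1
      has_value_of_nat has_value_numeral has_value_qvar)
    fix k assume k: "k \<in> {1..(n - 1) div 4}"
    then have "4 * k - 2 = 4 * (k - 1) + 2" "k - 1 < m" using n by auto
    then show "(1 - z ^ (4 * k - 2)) ^ 2 \<noteq> 0" using ne2[of "k - 1"] by simp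
  qed simp
  \<comment> \<open>The exponents \<open>4 * j + 2\<close> and \<open>4 * j + 4\<close> together are
    the even numbers from 2 to \<open>4 * m\<close>, so the two sums make up the half sum for the
    primitive root \<open>z ^ 2\<close>. It cancels the constant in \<open>b\<close>.\<close>
  have sum0: "(\<Sum>j<m. ?s j) + b = 0"
  proof -
    let ?f = "\<lambda>j. (z ^ 2) ^ (j + 1) / (1 - (z ^ 2) ^ (j + 1)) ^ 2"
    have "(\<Sum>j<2 * m. ?f j) = - (of_nat n ^ 2 - 1) / 24"
      using sum_half_inverse_square_chord[of "z ^ 2" "2 * m"] primitive_root_square[OF prim odd] n by simp
    moreover have "(\<Sum>j<2 * k. g j) = (\<Sum>j<k. g (2 * j)) + (\<Sum>j<k. g (2 * j + 1))" for k and g :: "nat \<Rightarrow> complex"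
      by (induction k) (simp_all add: algebra_simps)
    moreover have "(z ^ 2) ^ (2 * j + 1 + 1) = z ^ (4 * j + 4)" "(z ^ 2) ^ (2 * j + 1) = z ^ (4 * j + 2)" for j
    proof -
      have "2 * (2 * j + 1 + 1) = 4 * j + 4" "2 * (2 * j + 1) = 4 * j + 2" by simp_all
      then show "(z ^ 2) ^ (2 * j + 1 + 1) = z ^ (4 * j + 4)" "(z ^ 2) ^ (2 * j + 1) = z ^ (4 * j + 2)"
        unfolding power_mult[symmetric] by (simp_all only:)
    qed
    moreover have "(\<Sum>k=1..(n - 1) div 4. z ^ (4 * k - 2) / (1 - z ^ (4 * k - 2)) ^ 2)
        = (\<Sum>j<m. z ^ (4 * j + 2) / (1 - z ^ (4 * j + 2)) ^ 2)"
    proof -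
      have "4 * Suc j - 2 = 4 * j + 2" for j by simp
      then show ?thesis using n unfolding One_nat_def sum.atLeast1_atMost_eq by simp
    qed
    ultimately show ?thesis
      unfolding b_def by (simp only:) (simp add: field_simps)
  qed
  have v_1: "has_value z (1 - ?\<tau> * G) 1"
    using has_value_diff[OF has_value_1 has_value_mult[OF v_\<tau> G(2)]] by simp
  have ne: "1 - ?\<tau> * G \<noteq> 0" using has_value_nonzero[OF v_1] by simp
  have FTF: "vertex n False True False = (1 - ?r) * Y"
    unfolding Y_def by (rule vertex_shifted_w_ratio(2)[OF n])
  have "vertex n False True True * (1 - ?\<tau> * G) = vertex n False True False"
    using vertex_shifted_w_ratio(1)[OF n] unfolding G(1) .
  then have FTT: "vertex n False True True = (1 - ?r) * Y / (1 - ?\<tau> * G)"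
    unfolding FTF using ne by (simp add: field_simps)
  \<comment> \<open>\<open>F\<close> is the discrepancy after \<open>(1 - qvar ^ n) ^ 3\<close> has
    been taken out; one zero of \<open>F\<close> at \<open>z\<close> gives order 4.\<close>
  define F where "F = - (Y * G / (?r * (1 - ?\<tau> * G))) - Q / ?q ^ m * (B n ?q / (1 - ?q) ^ 2)"
  have "has_value z F (- (Qz / z ^ m * (\<Sum>j<m. ?s j) / (1 * 1)) - Qz / z ^ m * b)"
    unfolding F_def using z0
    by (intro has_value_diff has_value_minus has_value_divide has_value_mult v_Y G v_r v_1 v_Q v_B has_value_power has_value_qvar) simp_all
  also have "- (Qz / z ^ m * (\<Sum>j<m. ?s j) / (1 * 1)) - Qz / z ^ m * b = - (Qz / z ^ m) * ((\<Sum>j<m. ?s j) + b)"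
    by (simp add: algebra_simps)
  finally have "ord_ge z 1 F"
    unfolding sum0 by (intro has_value_0_imp_ord_ge_1) simp
  moreover have "ord_ge z 3 ((1 - ?r) ^ 3)"
    using ord_ge_power[OF ord_ge_1_one_minus_power[OF prim dvd_refl], of 3] by simp
  ultimately have "ord_ge z (3 + 1) ((1 - ?r) ^ 3 * F)"
    by (intro ord_ge_mult)
  moreover have "(1 - ?r) ^ 3 * F = vertex n False True False - vertex n False True True
      - (1 - ?r) / ?q ^ m * Q * (qint ?q n ^ 2 * B n ?q)"
  proof -
    have "vertex n False True False - vertex n False True True = (1 - ?r) * Y * (1 - 1 / (1 - ?\<tau> * G))"
      unfolding FTF FTT by (simp add: algebra_simps)
    also have "1 - 1 / (1 - ?\<tau> * G) = - (?\<tau> * G) / (1 - ?\<tau> * G)"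
      using ne by (simp add: field_simps)
    also have "(1 - ?r) * Y * (- (?\<tau> * G) / (1 - ?\<tau> * G)) = (1 - ?r) ^ 3 * - (Y * G / (?r * (1 - ?\<tau> * G)))"
      by (simp add: power3_eq_cube power2_eq_square mult_ac)
    finally have "vertex n False True False - vertex n False True True = (1 - ?r) ^ 3 * - (Y * G / (?r * (1 - ?\<tau> * G)))" .
    moreover have "(1 - ?r) / ?q ^ m * Q * (qint ?q n ^ 2 * B n ?q) = (1 - ?r) ^ 3 * (Q / ?q ^ m * (B n ?q / (1 - ?q) ^ 2))"
      unfolding qint_def power_divide by (simp add: power3_eq_cube power2_eq_square mult_ac)
    ultimately show ?thesis
      unfolding F_def by (simp only: right_diff_distrib)
  qed
  ultimately have "ord_ge z 4 (vertex n False True False - vertex n False True True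
      - (1 - ?r) / ?q ^ m * Q * (qint ?q n ^ 2 * B n ?q))"
    by simp
  from ord_ge_add[OF ord_ge_4_vertex[OF prim odd n1] this]
  show ?thesis
    unfolding vertex_shifted_x[OF n] Q_def[symmetric] by (simp add: algebra_simps)
qed

section \<open>From orders of vanishing to the congruence\<close>

lemma obtain_primitive_root_order:
  assumes "z ^ n = 1" "n > 0"
  obtains d where "primitive_root z d" "d dvd n" "d > 0"
proof -
  define d where "d = (LEAST d. d > 0 \<and> z ^ d = 1)"
  have d: "d > 0 \<and> z ^ d = 1"
    unfolding d_def by (rule LeastI[of _ n]) (use assms in simp)
  have least: "d \<le> k" if "k > 0" "z ^ k = 1" for k
    unfolding d_def by (rule Least_le) (use that in simp)
  have prim: "primitive_root z d"
    unfolding primitive_root_def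
  proof (intro allI iffI)
    fix j assume "z ^ j = 1"
    have "z ^ j = (z ^ d) ^ (j div d) * z ^ (j mod d)"
      by (simp add: power_mult[symmetric] power_add[symmetric])
    then have "z ^ (j mod d) = 1" using d \<open>z ^ j = 1\<close> by simp
    then have "j mod d = 0" using least[of "j mod d"] d mod_less_divisor[of d j] by linarith
    then show "d dvd j" by auto
  next
    fix j assume "d dvd j"
    then show "z ^ j = 1" using d by (auto simp: power_mult elim!: dvdE)
  qed
  moreover have "d dvd n" using prim assms(1) by (simp add: primitive_root_def)
  ultimately show ?thesis using that d by blast
qed

lemma primitive_root_cis:
  assumes n: "n > 0" and k: "coprime k n"
  shows "primitive_root (cis (2 * pi * real k / real n)) n"
  unfolding primitive_root_def
proof
  fix j
  have "cis (2 * pi * real k / real n) ^ j = cis (2 * pi * (real (k * j) / real n))"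
    by (simp add: DeMoivre mult_ac)
  also have "\<dots> = 1 \<longleftrightarrow> n dvd k * j"
  proof
    assume "cis (2 * pi * (real (k * j) / real n)) = 1"
    then have "cos (2 * pi * (real (k * j) / real n)) = 1"
      by (simp add: complex_eq_iff)
    then obtain i :: int where "2 * pi * (real (k * j) / real n) = real_of_int i * 2 * pi"
      unfolding cos_one_2pi_int by blast
    then have "2 * pi * (real (k * j) / real n) = 2 * pi * real_of_int i" by (simp only: mult_ac)
    then have "real (k * j) / real n = i" by (simp only: mult_cancel_left) simp
    then have "real_of_int (int (k * j)) = real_of_int (i * int n)" using n by (simp add: field_simps)
    then have "int (k * j) = i * int n" by (simp only: of_int_eq_iff)
    then have "int n dvd int (k * j)" by simp
    then show "n dvd k * j" by (simp only: int_dvd_int_iff)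
  next
    assume "n dvd k * j"
    then obtain i where "k * j = n * i" by (elim dvdE)
    then have "real (k * j) / real n = real i" using n by simp
    then show "cis (2 * pi * (real (k * j) / real n)) = 1" by simp
  qed
  also have "\<dots> \<longleftrightarrow> n dvd j"
    using k by (simp add: coprime_commute coprime_dvd_mult_right_iff)
  finally show "cis (2 * pi * real k / real n) ^ j = 1 \<longleftrightarrow> n dvd j" .
qed

text \<open>Distinct indices give distinct roots, so the product over exponents becomes one over a
  set and the linear factors are pairwise coprime.\<close>

lemma cyclotomic_eq_prod_primitive_roots:
  assumes n: "n > 0"
  obtains R where "finite R" "\<And>z. z \<in> R \<Longrightarrow> primitive_root z n" "cyclotomic n = (\<Prod>z\<in>R. [:- z, 1:])"
proof -
  define K where "K = {k \<in> {1..n}. coprime k n}"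
  let ?\<omega> = "\<lambda>k. cis (2 * pi * real k / real n)"
  have "inj_on ?\<omega> {1..n}"
  proof (rule linorder_inj_onI)
    fix i j assume ij: "i < j" "i \<in> {1..n}" "j \<in> {1..n}"
    define w where "w = cis (2 * pi * real 1 / real n)"
    have prim: "primitive_root w n"
      unfolding w_def using n by (intro primitive_root_cis) simp_all
    have pow: "?\<omega> k = w ^ k" for k
      by (simp add: w_def DeMoivre mult_ac)
    show "?\<omega> i \<noteq> ?\<omega> j"
    proof
      assume "?\<omega> i = ?\<omega> j"
      then have "w ^ i * 1 = w ^ j"
        unfolding pow by simp
      also have "\<dots> = w ^ i * w ^ (j - i)"
        using ij(1) by (simp add: power_add[symmetric])
      finally have "w ^ i * 1 = w ^ i * w ^ (j - i)" .
      moreover have "w \<noteq> 0" by (simp add: w_def)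
      ultimately have "w ^ (j - i) = 1"
        by (simp only: mult_cancel_left power_eq_0_iff) simp
      then have "n dvd j - i" using prim by (simp only: primitive_root_def)
      then show False using ij by (auto dest!: dvd_imp_le)
    qed
  qed auto
  then have "inj_on ?\<omega> K" by (rule inj_on_subset) (auto simp: K_def)
  then have "cyclotomic n = (\<Prod>z\<in>?\<omega> ` K. [:- z, 1:])"
    unfolding cyclotomic_def K_def by (simp add: prod.reindex)
  then show ?thesis
    using that[of "?\<omega> ` K"] primitive_root_cis[OF n] by (auto simp: K_def)
qed

lemma qint_poly_mult: "(1 - [:0, 1:]) * qint_poly n = 1 - [:0, 1:] ^ n"
proof -
  have "1 - [:0, 1:] dvd (1 - [:0, 1:] ^ n :: complex poly)"
    by (metis dvd_triv_left one_diff_power_eq)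
  then show ?thesis unfolding qint_poly_def by simp
qed

text \<open>Differentiating \<open>(1 - X) * P = 1 - X ^ n\<close>, with \<open>P\<close> the
  q-integer polynomial, shows that a common root of \<open>P\<close> and its derivative would be 0,
  where \<open>P\<close> is nonzero. So all roots are simple.\<close>

lemma qint_poly_eq_prod_roots:
  assumes n: "n > 0"
  shows "\<exists>c. qint_poly n = smult c (\<Prod>z | z ^ n = 1 \<and> z \<noteq> 1. [:- z, 1:])"
proof -
  let ?P = "qint_poly n"
  have ev: "(1 - z) * poly ?P z = 1 - z ^ n" for z
    using arg_cong[OF qint_poly_mult[of n], of "\<lambda>p. poly p z"] by simp
  have der: "(1 - z) * poly (pderiv ?P) z - poly ?P z = - of_nat n * z ^ (n - 1)" for z
    using arg_cong[OF qint_poly_mult[of n], of "\<lambda>p. poly (pderiv p) z"]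
    by (simp add: pderiv_mult pderiv_diff pderiv_power pderiv_pCons)
  have "rsquarefree ?P"
    unfolding rsquarefree_roots
  proof (intro allI notI)
    fix z assume z: "poly ?P z = 0 \<and> poly (pderiv ?P) z = 0"
    then have "of_nat n * z ^ (n - 1) = 0" using der[of z] by simp
    then have "z = 0" using n by simp
    then show False using ev[of z] z n by (simp add: power_0_left)
  qed
  then have decomp: "?P = smult (lead_coeff ?P) (\<Prod>z|poly ?P z = 0. [:-z, 1:])"
    by (rule complex_poly_decompose_rsquarefree[symmetric])
  have roots: "{z. poly ?P z = 0} = {z. z ^ n = 1 \<and> z \<noteq> 1}"
  proof (intro set_eqI)
    fix z
    show "z \<in> {z. poly ?P z = 0} \<longleftrightarrow> z \<in> {z. z ^ n = 1 \<and> z \<noteq> 1}"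
    proof (cases "z = 1")
      case True
      then show ?thesis using der[of 1] n by auto
    next
      case False
      then show ?thesis using ev[of z] by auto
    qed
  qed
  show ?thesis by (rule exI) (rule decomp[unfolded roots])
qed

lemma coprime_linear_factors:
  fixes a b :: complex
  assumes "a \<noteq> b"
  shows "coprime [:- a, 1:] [:- b, 1:]"
proof (rule coprimeI)
  fix c assume c: "c dvd [:- a, 1:]" "c dvd [:- b, 1:]"
  have "c dvd [:- a, 1:] - [:- b, 1:]" by (rule dvd_diff[OF c])
  then have "c dvd [:b - a:]" by simp
  moreover have "is_unit [:b - a:]" using assms by (simp add: is_unit_const_poly_iff dvd_field_iff)
  ultimately show "is_unit c" by (rule dvd_unit_imp_unit)
qed

lemma prod_linear_powers_dvd:
  fixes N :: "complex poly"
  assumes "finite R" "\<And>z. z \<in> R \<Longrightarrow> [:- z, 1:] ^ e z dvd N"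
  shows "(\<Prod>z\<in>R. [:- z, 1:] ^ e z) dvd N"
  using assms
proof (induction R rule: finite_induct)
  case (insert a R)
  have "coprime ([:- a, 1:] ^ e a) (\<Prod>z\<in>R. [:- z, 1:] ^ e z)"
  proof (rule prod_coprime_right)
    fix z assume "z \<in> R"
    then have "coprime [:- a, 1:] [:- z, 1:]"
      using insert.hyps(2) by (intro coprime_linear_factors) auto
    then show "coprime ([:- a, 1:] ^ e a) ([:- z, 1:] ^ e z)"
      by simp
  qed
  then show ?case
    using insert by (simp add: divides_mult)
qed simp

text \<open>Clearing denominators makes \<open>[:- z, 1:] ^ k\<close> divide \<open>E * N\<close>,
  and \<open>E\<close> is coprime to it because \<open>E\<close> does not vanish at
  \<open>z\<close>.\<close>

lemma ord_ge_imp_dvd: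
  assumes ord: "ord_ge z k (to_fract N / to_fract D)" and D: "D \<noteq> 0"
  shows "[:- z, 1:] ^ k dvd N"
proof -
  obtain A E where E: "poly E z \<noteq> 0" and eq: "to_fract N / to_fract D = to_fract [:- z, 1:] ^ k * (to_fract A / to_fract E)"
    using ord unfolding ord_ge_def has_value_def by blast
  have "E \<noteq> 0" using E by auto
  moreover have "to_fract N / to_fract D = (to_fract [:- z, 1:] ^ k * to_fract A) / to_fract E"
    using eq by (simp only: times_divide_eq_right)
  ultimately have "to_fract N * to_fract E = to_fract [:- z, 1:] ^ k * to_fract A * to_fract D"
    using D by (subst (asm) frac_eq_eq) simp_all
  then have "to_fract (N * E) = to_fract ([:- z, 1:] ^ k * A * D)"
    by (simp only: to_fract_mult to_fract_power)
  then have "N * E = [:- z, 1:] ^ k * A * D"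
    by (simp only: to_fract_eq_iff)
  then have "E * N = [:- z, 1:] ^ k * (A * D)"
    by (simp only: mult_ac)
  then have "[:- z, 1:] ^ k dvd E * N" ..
  moreover have "coprime ([:- z, 1:] ^ k) E"
  proof -
    have "coprime [:- z, 1:] E"
      using E by (intro prime_elem_imp_coprime prime_elem_linear_field_poly) (simp_all add: poly_eq_0_iff_dvd)
    then show ?thesis by simp
  qed
  ultimately show ?thesis
    by (simp add: coprime_dvd_mult_right_iff)
qed

text \<open>The modulus has zeros of multiplicity 1 + 3 at the primitive \<open>n\<close>-th roots
  of unity and simple zeros at the other \<open>n\<close>-th roots except 1. Coprimality of the
  denominator comes from lowest terms.\<close>

lemma ratfun_cong_if_ord_ge:
  assumes n: "n > 1"
    and prim: "\<And>z. primitive_root z n \<Longrightarrow> ord_ge z 4 (f - g)"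
    and nonprim: "\<And>z d. primitive_root z d \<Longrightarrow> d dvd n \<Longrightarrow> d > 1 \<Longrightarrow> d < n \<Longrightarrow> ord_ge z 1 (f - g)"
  shows "ratfun_cong f g (qint_poly n * cyclotomic n ^ 3)"
proof -
  obtain N D where ND: "quot_of_fract (f - g) = (N, D)" by (cases "quot_of_fract (f - g)")
  have D: "D \<noteq> 0" using snd_quot_of_fract_nonzero[of "f - g"] ND by simp
  have cop: "coprime N D" using coprime_quot_of_fract[of "f - g"] ND by simp
  have fg: "f - g = to_fract N / to_fract D"
    using Fract_quot_of_fract[of "f - g"] ND D by (simp add: Fract_conv_to_fract)
  obtain Rp where Rp: "finite Rp" "\<And>z. z \<in> Rp \<Longrightarrow> primitive_root z n" "cyclotomic n = (\<Prod>z\<in>Rp. [:- z, 1:])"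
    using cyclotomic_eq_prod_primitive_roots[of n] n by auto
  define R where "R = {z :: complex. z ^ n = 1 \<and> z \<noteq> 1}"
  have "finite {z :: complex. z ^ n = 1}"
    using n bij_betw_finite[OF bij_betw_roots_unity[of n]] by simp
  then have finR: "finite R" by (rule rev_finite_subset) (auto simp: R_def)
  have RpR: "Rp \<subseteq> R"
  proof
    fix z assume "z \<in> Rp"
    then have *: "\<And>j. z ^ j = 1 \<longleftrightarrow> n dvd j" using Rp(2) by (simp add: primitive_root_def)
    show "z \<in> R" using *[of n] *[of 1] n by (simp add: R_def)
  qed
  obtain c where c: "qint_poly n = smult c (\<Prod>z\<in>R. [:- z, 1:])"
    using qint_poly_eq_prod_roots[of n] n unfolding R_def by auto
  define e where "e = (\<lambda>z. if z \<in> Rp then 4 else 1 :: nat)"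
  have dvd: "[:- z, 1:] ^ e z dvd N" if "z \<in> R" for z
  proof (rule ord_ge_imp_dvd[OF _ D], unfold fg[symmetric])
    show "ord_ge z (e z) (f - g)"
    proof (cases "z \<in> Rp")
      case True
      then show ?thesis using prim Rp(2) by (simp add: e_def)
    next
      case False
      have "z ^ n = 1" "n > 0" using that n by (simp_all add: R_def)
      then obtain d where d: "primitive_root z d" "d dvd n" "d > 0"
        by (rule obtain_primitive_root_order)
      have "d \<noteq> 1" using d(1) that by (auto simp: primitive_root_def R_def dest: spec[of _ 1])
      show ?thesis
      proof (cases "d = n")
        case True
        \<comment> \<open>The choice of \<open>Rp\<close> does not assert that every primitive root
          lies in it; order 4 more than covers this case.\<close>
        then show ?thesis using prim d(1) ord_ge_mono[of z 4 "f - g" 1] by (simp add: e_def False)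
      next
        case False
        then have "d < n" using d(2) n by (auto dest!: dvd_imp_le)
        then show ?thesis using nonprim[OF d(1,2)] \<open>d \<noteq> 1\<close> d(3) \<open>z \<notin> Rp\<close> by (simp add: e_def)
      qed
    qed
  qed
  have "(\<Prod>z\<in>R. [:- z, 1:]) * cyclotomic n ^ 3 = (\<Prod>z\<in>R. [:- z, 1:] ^ e z)"
  proof -
    have "cyclotomic n ^ 3 = (\<Prod>z\<in>R. if z \<in> Rp then [:- z, 1:] ^ 3 else 1)"
      unfolding Rp(3) prod_power_distrib using finR RpR
      by (simp add: prod.inter_restrict[symmetric] Int_absorb1)
    then show ?thesis
      unfolding prod.distrib[symmetric] by (simp only:, simp only: prod.distrib[symmetric])
        (intro prod.cong, simp_all add: e_def numeral_eq_Suc)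
  qed
  then have "(\<Prod>z\<in>R. [:- z, 1:]) * cyclotomic n ^ 3 dvd N"
    using prod_linear_powers_dvd[OF finR dvd] by simp
  moreover have "c \<noteq> 0"
  proof
    assume "c = 0"
    then have "1 - [:0, 1:] ^ n = (0 :: complex poly)" using c qint_poly_mult[of n] by simp
    then have "poly (1 - [:0, 1:] ^ n) 0 = (0 :: complex)" by (simp only: poly_0)
    then show False using n by (simp add: power_0_left)
  qed
  ultimately have dvdN: "qint_poly n * cyclotomic n ^ 3 dvd N"
    unfolding c by (simp add: smult_dvd)
  then have "coprime D (qint_poly n * cyclotomic n ^ 3)"
    using cop by (meson coprime_commute coprime_divisors dvd_refl)
  then show ?thesis
    unfolding ratfun_cong_def using D cop fg dvdN by blast
qed

text \<open>\<open>B\<close> may have poles at \<open>z\<close>, but each is cancelled by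
  \<open>[n]^2\<close>: the zero of \<open>1 - qvar ^ (4 * k - 2)\<close> is at most simple and
  \<open>1 - qvar ^ n\<close> vanishes at \<open>z\<close>.\<close>

lemma ord_ge_0_qint_B:
  assumes prim: "primitive_root z d" and d: "d dvd n"
  shows "ord_ge z 0 (qint qvar n ^ 2 * B n qvar)"
proof -
  let ?q = qvar
  have expand: "qint ?q n ^ 2 * B n ?q = (1 - ?q ^ n) ^ 2 * ((of_nat n ^ 2 - 1) / 24)
      + (\<Sum>k=1..(n - 1) div 4. ?q ^ (4 * k - 2) * ((1 - ?q ^ n) / (1 - ?q ^ (4 * k - 2))) ^ 2)"
    unfolding B_def qint_def distrib_left sum_distrib_left power_divide
    by (intro arg_cong2[where f = "(+)"] sum.cong refl) (simp_all add: field_simps)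
  have "has_value z ((1 - ?q ^ n) ^ 2 * ((of_nat n ^ 2 - 1) / 24)) ((1 - z ^ n) ^ 2 * ((of_nat n ^ 2 - 1) / 24))"
    by (intro has_value_intros) simp
  moreover have "ord_ge z 0 (?q ^ (4 * k - 2) * ((1 - ?q ^ n) / (1 - ?q ^ (4 * k - 2))) ^ 2)" if "k \<ge> 1" for k
  proof (rule ord_ge_mult_0)
    show "ord_ge z 0 (?q ^ (4 * k - 2))"
      by (rule has_value_imp_ord_ge_0, rule has_value_power, rule has_value_qvar)
    have "ord_ge z 0 ((1 - ?q ^ n) / (1 - ?q ^ (4 * k - 2)))"
      using that by (intro ord_ge_0_one_minus_power_ratio[OF prim d]) simp
    from ord_ge_power[OF this, of 2] show "ord_ge z 0 (((1 - ?q ^ n) / (1 - ?q ^ (4 * k - 2))) ^ 2)"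
      by simp
  qed
  ultimately show ?thesis
    unfolding expand by (intro ord_ge_add ord_ge_sum) (auto intro: has_value_imp_ord_ge_0)
qed

theorem theorem2:
  fixes n :: nat and q :: ratfun
  defines "q \<equiv> qvar"
  assumes "n > 0" and "[n = 1] (mod 4)"
  shows "ratfun_cong
    (\<Sum>k=0..(n - 1) div 2.
       qint q (6 * k + 1)
       * (qpoch q (q ^ 4) k * qpoch q (q ^ 2) k ^ 3)
       / (qpoch (q ^ 2) (q ^ 2) k * qpoch (q ^ 4) (q ^ 4) k ^ 3)
       * q ^ (k ^ 2 + k))
    (qpoch (q ^ 2) (q ^ 4) ((n - 1) div 4) / qpoch (q ^ 4) (q ^ 4) ((n - 1) div 4)
       * qint q n * q powi ((1 - int n) div 4) * (1 + qint q n ^ 2 * B n q))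
    (qint_poly n * cyclotomic n ^ 3)"
    (is "ratfun_cong ?f ?g _")
proof -
  define m where "m = (n - 1) div 4"
  have n: "n = 4 * m + 1"
  proof -
    have "n mod 4 = 1" using assms(3) by (simp add: cong_def)
    then show ?thesis unfolding m_def using mult_div_mod_eq[of 4 n] by presburger
  qed
  define Q where "Q = (\<Prod>i<m. (1 - qvar ^ (4 * i + 2)) / (1 - qvar ^ (4 * i + 4)))"
  define S where "S = (\<Sum>k\<le>(n - 1) div 2. (1 - qvar ^ (6 * k + 1)) * gterm k)"
  define W where "W = (1 - qvar ^ n) / qvar ^ m * Q * (1 + qint qvar n ^ 2 * B n qvar)"
  \<comment> \<open>The q-integers share the denominator \<open>1 - qvar\<close>, which is pulled
    out of both sides; it is nonzero at every root considered.\<close>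
  have f: "?f = S / (1 - qvar)"
    unfolding S_def sum_divide_distrib atLeast0AtMost q_def
  proof (rule sum.cong[OF refl])
    fix k
    show "qint qvar (6 * k + 1) * (qpoch qvar (qvar ^ 4) k * qpoch qvar (qvar ^ 2) k ^ 3)
       / (qpoch (qvar ^ 2) (qvar ^ 2) k * qpoch (qvar ^ 4) (qvar ^ 4) k ^ 3) * qvar ^ (k ^ 2 + k)
      = (1 - qvar ^ (6 * k + 1)) * gterm k / (1 - qvar)"
      unfolding summand_eq_gterm[symmetric] qint_def by (simp add: mult_ac)
  qed
  have g: "?g = W / (1 - qvar)"
  proof -
    have "(1 - int n) div 4 = - int m"
      unfolding n by simp
    then have "qvar powi ((1 - int n) div 4) = 1 / qvar ^ m"
      by (simp add: power_int_minus divide_inverse)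
    moreover have "qpoch (qvar ^ 2) (qvar ^ 4) m / qpoch (qvar ^ 4) (qvar ^ 4) m = Q"
      unfolding qpoch_def Q_def prod_dividef[symmetric] power_mult[symmetric] power_add[symmetric]
      by (simp add: add.commute)
    ultimately show ?thesis
      unfolding q_def W_def m_def[symmetric] by (simp add: qint_def mult_ac)
  qed
  show ?thesis
  proof (cases "m = 0")
    case True
    \<comment> \<open>For \<open>n = 1\<close> both sides coincide; the arguments at roots of unity
      need \<open>n > 1\<close>.\<close>
    then have "S = W"
      by (simp add: S_def W_def Q_def n gterm_def B_def)
    then have "?f - ?g = to_fract 0 / to_fract 1"
      using f g by simp
    then show ?thesis
      unfolding ratfun_cong_def by (intro exI[of _ 0] exI[of _ 1] conjI) (simp_all add: True n qint_poly_def)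
  next
    case False
    have fg: "?f - ?g = (S - W) * inverse (1 - qvar)"
      unfolding f g by (simp add: divide_inverse left_diff_distrib)
    have inv: "ord_ge z 0 (inverse (1 - qvar))" if "primitive_root z d" "d > 1" for z d
    proof -
      have "1 - z \<noteq> 0" using primitive_root_ne[OF that(1) coprime_1_left, of 1] that(2) by simp
      then show ?thesis
        using has_value_imp_ord_ge_0[OF has_value_inverse[OF has_value_diff[OF has_value_1 has_value_qvar]]] by simp
    qed
    show ?thesis
    proof (rule ratfun_cong_if_ord_ge)
      show "n > 1" using False n by simp
      show "ord_ge z 4 (?f - ?g)" if "primitive_root z n" for z
        unfolding fg
      proof (rule ord_ge_mult_0[OF _ inv[OF that \<open>n > 1\<close>]])
        show "ord_ge z 4 (S - W)"
          unfolding S_def W_def Q_def vertex_origin[symmetric] using False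
          by (intro ord_ge_4_main[OF that n]) simp
      qed
      \<comment> \<open>At a root of lower order both sides vanish separately: \<open>S\<close> by
        blocks, \<open>W\<close> through its factor \<open>1 - qvar ^ n\<close>, the rest of
        \<open>W\<close> being regular.\<close>
      show "ord_ge z 1 (?f - ?g)" if prim: "primitive_root z d" and d: "d dvd n" "d > 1" for z d
        unfolding fg
      proof (rule ord_ge_mult_0[OF ord_ge_diff inv[OF prim d(2)]])
        have "odd n" using n by simp
        then have odd: "odd d" using d(1) by (meson dvd_trans)
        obtain e where e: "n = d * e" using d(1) by (elim dvdE)
        then have "odd e" using \<open>odd n\<close> by simp
        then obtain L where "e = 2 * L + 1" by (elim oddE)
        then show "ord_ge z 1 S"
          unfolding S_def using e by (intro ord_ge_1_sum_gterm[OF prim odd d(2), where L = L]) simp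
        have d0: "d > 0" using d by simp
        have z0: "z ^ m \<noteq> 0" using primitive_root_nonzero[OF prim d0] by simp
        have "ord_ge z 0 Q"
        proof -
          have "Q = (\<Prod>i<m. 1 - qvar ^ (4 * i + 2)) / (\<Prod>i<m. 1 - qvar ^ (4 * (i + 1)))"
            unfolding Q_def prod_dividef by (simp add: add.commute)
          moreover have "coprime 4 d" using odd_imp_coprime_powers_of_two[OF odd] by simp
          ultimately show ?thesis
            using ord_ge_0_qpoch_ratio[OF prim _ _ _ d0, of 4 4 2 m] by (simp only:)
        qed
        moreover have "ord_ge z 0 (1 / qvar ^ m)"
          using has_value_imp_ord_ge_0[OF has_value_divide[OF has_value_1 has_value_power[OF has_value_qvar] z0]] .
        moreover have "ord_ge z 0 (1 + qint qvar n ^ 2 * B n qvar)"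
          by (intro ord_ge_add ord_ge_0_qint_B[OF prim d(1)] has_value_imp_ord_ge_0[OF has_value_1])
        moreover have "W = (1 - qvar ^ n) * (1 / qvar ^ m * Q * (1 + qint qvar n ^ 2 * B n qvar))"
          unfolding W_def by simp
        ultimately show "ord_ge z 1 W"
          by (simp only:) (intro ord_ge_mult_0 ord_ge_1_one_minus_power[OF prim d(1)])
      qed
    qed
  qed
qed

end
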